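(* Let $1<p<\infty$, let $\nu\in A_p(0,2\pi)$ satisfy $\nu(x)=\nu(2\pi-x)$ for a.e. $x\in(0,2\pi)$, let $f\in W^{1,p}_\nu(0,2\pi)$ be such that $f(0)=f(2\pi)=0$, and let $h\in L^1(\mathbb{R}_+)$. If the problem $$\begin{cases}\displaystyle\iint_\Pi\nabla u\cdot\nabla\varphi\,dx\,dy+\int_0^\infty\varphi(0,y)h(y)\,dy=0 & \forall\,\varphi\in C^\infty_{J_0}(\overline{\Pi}),\\ u(0,y)=u(2\pi,y) & y\in(0,\infty),\\ u(x,0)=f(x) & x\in(0,2\pi)\end{cases}$$ has a weak solution $u\in W^{1,p}_\nu(\Pi)$, then it is unique (that is, any two weak solutions in $W^{1,p}_\nu(\Pi)$ of this problem coincide a.e. in $\Pi$).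
   Context: $\mathbb{R}_+=(0,\infty)$; $\Pi=(0,2\pi)\times(0,\infty)$, with boundary pieces $J=\{(x,0):x\in(0,2\pi)\}$, $J_0=\{(0,y):y\in(0,\infty)\}$, $J_{2\pi}=\{(2\pi,y):y\in(0,\infty)\}$. Test functions: $C^\infty_{J_0}(\overline\Pi)$ is the set of all $\varphi\in C^\infty(\overline\Pi)$ such that $\varphi|_{J\cup J_{2\pi}}=0$ and there exists $\xi_\varphi>0$ with $\varphi(x,y)=0$ for all $(x,y)\in[0,2\pi]\times[\xi_\varphi,\infty)$. Weights: $A_p(0,2\pi)$ is the Muckenhoupt class of $2\pi$-periodic weights $\nu$ (measurable, with values in $[0,\infty]$, with $\nu\in L^1(0,2\pi)$ and $|\nu^{-1}(\{0;\infty\})|=0$) satisfying $$\sup_{I\subset\mathbb{R}}\Big(\frac1{|I|}\int_I\nu\,dx\Big)\Big(\frac1{|I|}\int_I\nu^{-\frac1{p-1}}\,dx\Big)^{p-1}<\infty,$$ the supremum being over all bounded intervals $I\subset\mathbb{R}$. Spaces: $\|f\|_{L^p_\nu(0,2\pi)}=\big(\int_0^{2\pi}|f|^p\nu\,dx\big)^{1/p}$ and $\|f\|_{W^{m,p}_\nu(0,2\pi)}=\sum_{k=0}^m\|f^{(k)}\|_{L^p_\nu(0,2\pi)}$. On the strip (the weight depends only on $x$), $$\|u\|_{L^p_\nu(\Pi)}=\int_0^\infty\Big(\int_0^{2\pi}|u(x,y)|^p\nu(x)\,dx\Big)^{1/p}dy,$$ and $W^{m,p}_\nu(\Pi)$ is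 the set of measurable functions on $\Pi$ whose distributional derivatives up to order $m$ lie in $L^p_\nu(\Pi)$, with norm $\|u\|_{W^{m,p}_\nu(\Pi)}=\sum_{0\le|\alpha|\le m}\|D^\alpha u\|_{L^p_\nu(\Pi)}$. Weak solution: a function $u\in W^{1,p}_\nu(\Pi)$ satisfying the displayed integral identity for every $\varphi\in C^\infty_{J_0}(\overline\Pi)$ and the two boundary conditions; boundary values are understood a.e. in the sense of traces (functions in $W^{1,p}_\nu(\Pi)$ belong to $W^{1,1}(\Pi_\xi)$ on every rectangle $\Pi_\xi=(0,2\pi)\times(0,\xi)$, so traces exist). *)

theory Defs
  imports "HOL-Analysis.Analysis"
begin

definition epowr :: "ennreal \<Rightarrow> real \<Rightarrow> ennreal"  (infixr "epowr" 80)
  where "x epowr a =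
    (if a = 0 then 1
     else if x = 0 then (if a < 0 then \<infinity> else 0)
     else if x = \<infinity> then (if a < 0 then 0 else \<infinity>)
     else ennreal (enn2real x powr a))"

definition mean_value :: "real \<Rightarrow> real \<Rightarrow> (real \<Rightarrow> ennreal) \<Rightarrow> ennreal"
  where "mean_value a b w = (\<integral>\<^sup>+ x. w x \<partial>lebesgue_on {a..b}) / ennreal (b - a)"

definition Muckenhoupt :: "real \<Rightarrow> (real \<Rightarrow> ennreal) set"
  where "Muckenhoupt p = {\<nu>.
    \<nu> \<in> borel_measurable lebesgue \<and>
    (\<forall>x. \<nu> (x + 2 * pi) = \<nu> x) \<and>
    (\<integral>\<^sup>+ x. \<nu> x \<partial>lebesgue_on {0<..<2 * pi}) < \<infinity> \<and>
    \<nu> -` {0, \<infinity>} \<in> null_sets lebesgue \<and>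
    (SUP (a, b) \<in> {(a, b). a < b}.
       mean_value a b \<nu> * mean_value a b (\<lambda>x. \<nu> x epowr (- 1 / (p - 1))) epowr (p - 1)) < \<infinity>}"

text \<open>
  \<^term>\<open>smooth_upto \<Omega> \<phi>\<close> is \<open>\<phi> \<in> C\<^sup>\<infinity>(\<close>closure of \<open>\<Omega>)\<close> for an open set \<open>\<Omega>\<close>: all iterated partial derivatives
  exist in \<open>\<Omega>\<close> and extend continuously to the closure. \<open>D bs\<close> is the (extended) iterated partial
  derivative of \<open>\<phi>\<close> along the list \<open>bs\<close> of basis vectors. For \<open>\<Omega> = UNIV\<close> this is ordinary smoothness.
  Values of \<open>\<phi>\<close> outside the closure are irrelevant.
\<close>

definition smooth_upto :: "'a::euclidean_space set \<Rightarrow> ('a \<Rightarrow> real) \<Rightarrow> bool"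
  where "smooth_upto \<Omega> \<phi> \<longleftrightarrow> (\<exists>D :: 'a list \<Rightarrow> 'a \<Rightarrow> real.
    (\<forall>x \<in> closure \<Omega>. D [] x = \<phi> x) \<and>
    (\<forall>bs. set bs \<subseteq> Basis \<longrightarrow>
       continuous_on (closure \<Omega>) (D bs) \<and>
       (\<forall>x \<in> \<Omega>. GDERIV (D bs) x :> (\<Sum>b\<in>Basis. D (b # bs) x *\<^sub>R b))))"

definition gradient :: "('a::euclidean_space \<Rightarrow> real) \<Rightarrow> 'a \<Rightarrow> 'a"
  where "gradient \<phi> x = (\<Sum>b\<in>Basis. frechet_derivative \<phi> (at x) b *\<^sub>R b)"

definition test_functions :: "'a::euclidean_space set \<Rightarrow> ('a \<Rightarrow> real) set"
  where "test_functions \<Omega> = {\<phi>. smooth_upto UNIV \<phi> \<and>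
    compact (closure {x. \<phi> x \<noteq> 0}) \<and> closure {x. \<phi> x \<noteq> 0} \<subseteq> \<Omega>}"

definition locally_integrable ::
    "'a::euclidean_space set \<Rightarrow> ('a \<Rightarrow> 'b::euclidean_space) \<Rightarrow> bool"
  where "locally_integrable \<Omega> u \<longleftrightarrow>
    (\<forall>K. compact K \<and> K \<subseteq> \<Omega> \<longrightarrow> integrable (lebesgue_on K) u)"

text \<open>\<open>G\<close> is the distributional gradient of \<open>u\<close> in the open set \<open>\<Omega>\<close>; its component \<open>G x \<bullet> b\<close> is the
  distributional derivative in direction \<open>b\<close>. In dimension one \<open>G\<close> is the weak derivative.\<close>

definition weak_gradient ::
    "'a::euclidean_space set \<Rightarrow> ('a \<Rightarrow> real) \<Rightarrow> ('a \<Rightarrow> 'a) \<Rightarrow> bool"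
  where "weak_gradient \<Omega> u G \<longleftrightarrow>
    locally_integrable \<Omega> u \<and> locally_integrable \<Omega> G \<and>
    (\<forall>\<phi> \<in> test_functions \<Omega>. \<forall>b \<in> Basis.
       (LINT x|lebesgue_on \<Omega>. u x * (gradient \<phi> x \<bullet> b)) =
       - (LINT x|lebesgue_on \<Omega>. (G x \<bullet> b) * \<phi> x))"

definition Lp_interval_norm :: "real \<Rightarrow> (real \<Rightarrow> ennreal) \<Rightarrow> (real \<Rightarrow> real) \<Rightarrow> ennreal"
  where "Lp_interval_norm p \<nu> f =
    (\<integral>\<^sup>+ x. ennreal (\<bar>f x\<bar> powr p) * \<nu> x \<partial>lebesgue_on {0<..<2 * pi}) epowr (1 / p)"

definition Lp_interval :: "real \<Rightarrow> (real \<Rightarrow> ennreal) \<Rightarrow> (real \<Rightarrow> real) set"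
  where "Lp_interval p \<nu> =
    {f \<in> borel_measurable (lebesgue_on {0<..<2 * pi}). Lp_interval_norm p \<nu> f < \<infinity>}"

definition W1p_interval :: "real \<Rightarrow> (real \<Rightarrow> ennreal) \<Rightarrow> (real \<Rightarrow> real) set"
  where "W1p_interval p \<nu> =
    {f \<in> Lp_interval p \<nu>. \<exists>f' \<in> Lp_interval p \<nu>. weak_gradient {0<..<2 * pi} f f'}"

text \<open>Elements of the Sobolev space are classes of functions equal a.e.; their values at the end
  points are those of the continuous representative.\<close>

definition endpoint_values :: "(real \<Rightarrow> real) \<Rightarrow> real \<Rightarrow> real \<Rightarrow> bool"
  where "endpoint_values f l r \<longleftrightarrow> (\<exists>F. continuous_on {0..2 * pi} F \<and>
    (AE x in lebesgue_on {0<..<2 * pi}. F x = f x) \<and> F 0 = l \<and> F (2 * pi) = r)"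

definition strip :: "(real \<times> real) set"
  where "strip = {0<..<2 * pi} \<times> {0<..}"

definition rectangle :: "real \<Rightarrow> (real \<times> real) set"
  where "rectangle \<xi> = {0<..<2 * pi} \<times> {0<..<\<xi>}"

definition Lp_strip_norm :: "real \<Rightarrow> (real \<Rightarrow> ennreal) \<Rightarrow> (real \<times> real \<Rightarrow> real) \<Rightarrow> ennreal"
  where "Lp_strip_norm p \<nu> u =
    (\<integral>\<^sup>+ y. Lp_interval_norm p \<nu> (\<lambda>x. u (x, y)) \<partial>lebesgue_on {0<..})"

definition Lp_strip :: "real \<Rightarrow> (real \<Rightarrow> ennreal) \<Rightarrow> (real \<times> real \<Rightarrow> real) set"
  where "Lp_strip p \<nu> = {u \<in> borel_measurable (lebesgue_on strip). Lp_strip_norm p \<nu> u < \<infinity>}"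

definition W1p_strip :: "real \<Rightarrow> (real \<Rightarrow> ennreal) \<Rightarrow> (real \<times> real \<Rightarrow> real) set"
  where "W1p_strip p \<nu> =
    {u \<in> Lp_strip p \<nu>. \<exists>G. weak_gradient strip u G \<and> (\<forall>b \<in> Basis. (\<lambda>z. G z \<bullet> b) \<in> Lp_strip p \<nu>)}"

text \<open>\<open>g\<close> is the trace of \<open>u \<in> W\<^sup>1\<^sup>,\<^sup>1(\<Omega>)\<close> on the boundary segment \<open>\<gamma> ` T\<close> (with \<open>\<gamma>\<close> parametrised by
  arc length): \<open>u\<close> is a limit in \<open>W\<^sup>1\<^sup>,\<^sup>1(\<Omega>)\<close> of functions smooth up to the boundary whose restrictions
  to the segment converge to \<open>g\<close> in \<open>L\<^sup>1\<close>. This is meant for bounded Lipschitz domains \<open>\<Omega>\<close>.\<close>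

definition has_trace ::
    "'a::euclidean_space set \<Rightarrow> (real \<Rightarrow> 'a) \<Rightarrow> real set \<Rightarrow> ('a \<Rightarrow> real) \<Rightarrow> (real \<Rightarrow> real) \<Rightarrow> bool"
  where "has_trace \<Omega> \<gamma> T u g \<longleftrightarrow>
    g \<in> borel_measurable (lebesgue_on T) \<and> u \<in> borel_measurable (lebesgue_on \<Omega>) \<and>
    (\<exists>G \<in> borel_measurable (lebesgue_on \<Omega>). \<exists>\<Phi>.
       weak_gradient \<Omega> u G \<and>
       (\<forall>n::nat. smooth_upto \<Omega> (\<Phi> n)) \<and>
       (\<lambda>n. \<integral>\<^sup>+ z. ennreal \<bar>\<Phi> n z - u z\<bar> \<partial>lebesgue_on \<Omega>) \<longlonglongrightarrow> 0 \<and>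
       (\<lambda>n. \<integral>\<^sup>+ z. ennreal (norm (gradient (\<Phi> n) z - G z)) \<partial>lebesgue_on \<Omega>) \<longlonglongrightarrow> 0 \<and>
       (\<lambda>n. \<integral>\<^sup>+ t. ennreal \<bar>\<Phi> n (\<gamma> t) - g t\<bar> \<partial>lebesgue_on T) \<longlonglongrightarrow> 0)"

definition bottom_trace :: "(real \<times> real \<Rightarrow> real) \<Rightarrow> (real \<Rightarrow> real) \<Rightarrow> bool"
  where "bottom_trace u g \<longleftrightarrow>
    (\<forall>\<xi>>0. has_trace (rectangle \<xi>) (\<lambda>x. (x, 0)) {0<..<2 * pi} u g)"

definition vertical_trace :: "real \<Rightarrow> (real \<times> real \<Rightarrow> real) \<Rightarrow> (real \<Rightarrow> real) \<Rightarrow> bool"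
  where "vertical_trace a u g \<longleftrightarrow>
    (\<forall>\<xi>>0. has_trace (rectangle \<xi>) (\<lambda>y. (a, y)) {0<..<\<xi>} u g)"

definition strip_test_functions :: "(real \<times> real \<Rightarrow> real) set"
  where "strip_test_functions = {\<phi>. smooth_upto strip \<phi> \<and>
    (\<forall>x \<in> {0<..<2 * pi}. \<phi> (x, 0) = 0) \<and>
    (\<forall>y > 0. \<phi> (2 * pi, y) = 0) \<and>
    (\<exists>\<xi> > 0. \<forall>x \<in> {0..2 * pi}. \<forall>y \<ge> \<xi>. \<phi> (x, y) = 0)}"

text \<open>For \<open>\<nu>\<close> in the Muckenhoupt class and \<open>h\<close> integrable, both integrands in the integral identity
  are integrable, so the Bochner integral is the genuine one there.\<close>

definition weak_solution ::
    "real \<Rightarrow> (real \<Rightarrow> ennreal) \<Rightarrow> (real \<Rightarrow> real) \<Rightarrow> (real \<Rightarrow> real) \<Rightarrow> (real \<times> real \<Rightarrow> real) \<Rightarrow> bool"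
  where "weak_solution p \<nu> f h u \<longleftrightarrow>
    u \<in> W1p_strip p \<nu> \<and>
    (\<exists>G. weak_gradient strip u G \<and>
       (\<forall>b \<in> Basis. (\<lambda>z. G z \<bullet> b) \<in> Lp_strip p \<nu>) \<and>
       (\<forall>\<phi> \<in> strip_test_functions.
          (LINT z|lebesgue_on strip. G z \<bullet> gradient \<phi> z) +
          (LINT y|lebesgue_on {0<..}. \<phi> (0, y) * h y) = 0)) \<and>
    (\<exists>g\<^sub>0 g\<^sub>1. vertical_trace 0 u g\<^sub>0 \<and> vertical_trace (2 * pi) u g\<^sub>1 \<and>
       (AE y in lebesgue_on {0<..}. g\<^sub>0 y = g\<^sub>1 y)) \<and>
    (\<exists>g. bottom_trace u g \<and> (AE x in lebesgue_on {0<..<2 * pi}. g x = f x))"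

end

theory Submission
  imports Defs
begin

text \<open>
  Integrate by parts against products \<open>a x * b y\<close> with \<open>a (2\<pi>) = 0\<close>, \<open>a' 0 = a' (2\<pi>)\<close>, \<open>b 0 = 0\<close>: the
  condition \<open>u (0, y) = u (2\<pi>, y)\<close> cancels the lateral terms, and the remaining boundary terms only
  involve \<open>f\<close> and \<open>h\<close>. So the difference \<open>U\<close> of two solutions, which is integrable over the strip
  by the Muckenhoupt condition, is orthogonal to all \<open>a'' x * b y + a x * b'' y\<close>. Take for \<open>a\<close> the
  root functions \<open>sin (m x)\<close> and \<open>(2\<pi> - x) cos (m x)\<close>. The coefficient \<open>w y\<close> of \<open>U\<close> with respect to
  the first solves \<open>w'' = m\<^sup>2 w\<close>, \<open>w 0 = 0\<close> weakly, and it is integrable, hence zero; then the same holds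
  for the second. As the root functions are complete, \<open>U = 0\<close>.
\<close>

section \<open>Smooth functions of one variable\<close>

text \<open>An energy argument is not at hand: a difference of solutions is merely integrable in
  \<open>y\<close>, and the condition linking the two sides is nonlocal, so it is no admissible test
  function. Expansion in \<open>x\<close> takes its place. The operator a'' under the two conditions
  on \<open>a\<close> is not self-adjoint: for m >= 1 the eigenvalue -m^2 has only the eigenfunction
  sin (m x), completed by v = (2 pi - x) cos (m x) with v'' + m^2 v = 2 m sin (m x). This Jordan
  chain forces the order, sines before cosines; for m = 0 the function 2 pi - x is itself an
  eigenfunction. The equation for w is never solved. Testing with exp (-m y) - exp (-k y), which
  vanishes at y = 0, shows that the Laplace transform of w is zero at all integers k > m;
  integrability in \<open>y\<close> is what permits test functions without compact support. In the
  variable exp (-y) these values are moments, just as powers of cos x give moments in the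
  completeness proof. One moment lemma, Weierstrass approximation after a strictly decreasing change
  of variable, therefore serves both directions.\<close>

primrec times_differentiable :: "nat \<Rightarrow> (real \<Rightarrow> real) \<Rightarrow> bool" where
  "times_differentiable 0 f \<longleftrightarrow> True"
| "times_differentiable (Suc n) f \<longleftrightarrow>
     (\<exists>f'. (\<forall>x. (f has_real_derivative f' x) (at x)) \<and> times_differentiable n f')"

definition smooth :: "(real \<Rightarrow> real) \<Rightarrow> bool"
  where "smooth f \<longleftrightarrow> (\<forall>n. times_differentiable n f)"

lemma times_differentiable_Suc: "times_differentiable (Suc n) f \<Longrightarrow> times_differentiable n f"
  by (induction n arbitrary: f) auto

lemma times_differentiable_add:
  "times_differentiable n f \<Longrightarrow> times_differentiable n g \<Longrightarrow> times_differentiable n (\<lambda>x. f x + g x)"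
proof (induction n arbitrary: f g)
  case (Suc n)
  then obtain f' g' where "\<forall>x. (f has_real_derivative f' x) (at x)" "times_differentiable n f'"
    "\<forall>x. (g has_real_derivative g' x) (at x)" "times_differentiable n g'" by auto
  with Suc.IH show ?case
    by (auto intro!: exI[of _ "\<lambda>x. f' x + g' x"] derivative_eq_intros)
qed simp

lemma times_differentiable_mult:
  "times_differentiable n f \<Longrightarrow> times_differentiable n g \<Longrightarrow> times_differentiable n (\<lambda>x. f x * g x)"
proof (induction n arbitrary: f g)
  case (Suc n)
  then obtain f' g' where *: "\<forall>x. (f has_real_derivative f' x) (at x)" "times_differentiable n f'"
    "\<forall>x. (g has_real_derivative g' x) (at x)" "times_differentiable n g'" by auto
  have "times_differentiable n (\<lambda>x. f' x * g x + g' x * f x)"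
    using * Suc times_differentiable_Suc by (intro times_differentiable_add) auto
  with * show ?case
    by (auto intro!: exI[of _ "\<lambda>x. f' x * g x + g' x * f x"] derivative_eq_intros)
qed simp

lemma smooth_add: "smooth f \<Longrightarrow> smooth g \<Longrightarrow> smooth (\<lambda>x. f x + g x)"
  by (simp add: smooth_def times_differentiable_add)

lemma smooth_mult: "smooth f \<Longrightarrow> smooth g \<Longrightarrow> smooth (\<lambda>x. f x * g x)"
  by (simp add: smooth_def times_differentiable_mult)

text \<open>Any class of functions closed under differentiation consists of smooth functions. This
  serves the families whose derivatives keep their shape: constants, combinations of sine and
  cosine, multiples of an exponential, and \<open>bump P\<close> with varying
  \<open>P\<close>.\<close>

lemma smooth_coinduct:
  assumes "P f"
    and step: "\<And>f. P f \<Longrightarrow> \<exists>f'. P f' \<and> (\<forall>x. (f has_real_derivative f' x) (at x))"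
  shows "smooth f"
proof -
  have "times_differentiable n f" if "P f" for n f
    using that
  proof (induction n arbitrary: f)
    case (Suc n)
    from step[OF Suc.prems] Suc.IH show ?case by auto
  qed simp
  with assms(1) show ?thesis by (simp add: smooth_def)
qed

lemma smooth_const: "smooth (\<lambda>x. c)"
  by (rule smooth_coinduct[where P="\<lambda>f. \<exists>c. f = (\<lambda>x. c)"]) (auto intro!: derivative_eq_intros)

lemma smooth_diff: "smooth f \<Longrightarrow> smooth g \<Longrightarrow> smooth (\<lambda>x. f x - g x)"
  using smooth_add[OF _ smooth_mult[OF smooth_const[of "-1"]], of f g] by simp

lemma smooth_ident: "smooth (\<lambda>x. x)"
  unfolding smooth_def
proof
  show "times_differentiable n (\<lambda>x. x)" for n
    using smooth_const[of 1] by (cases n) (auto simp: smooth_def intro!: exI[of _ "\<lambda>_. 1"] derivative_eq_intros)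
qed

lemma smooth_sin: "smooth (\<lambda>x. sin (c * x))" and smooth_cos: "smooth (\<lambda>x. cos (c * x))"
proof -
  have *: "smooth (\<lambda>x. a * sin (c * x) + b * cos (c * x))" for a b
  proof (rule smooth_coinduct[where P="\<lambda>f. \<exists>a b. f = (\<lambda>x. a * sin (c * x) + b * cos (c * x))"])
    fix f :: "real \<Rightarrow> real" assume "\<exists>a b. f = (\<lambda>x. a * sin (c * x) + b * cos (c * x))"
    then obtain a b where f: "f = (\<lambda>x. a * sin (c * x) + b * cos (c * x))" by blast
    have "\<forall>x. (f has_real_derivative (- b * c) * sin (c * x) + (a * c) * cos (c * x)) (at x)"
      unfolding f by (auto intro!: derivative_eq_intros)
    then show "\<exists>f'. (\<exists>a b. f' = (\<lambda>x. a * sin (c * x) + b * cos (c * x))) \<and>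
        (\<forall>x. (f has_real_derivative f' x) (at x))" by blast
  qed blast
  show "smooth (\<lambda>x. sin (c * x))" using *[of 1 0] by simp
  show "smooth (\<lambda>x. cos (c * x))" using *[of 0 1] by simp
qed

lemma smooth_exp: "smooth (\<lambda>x. exp (c * x))"
proof -
  have "smooth (\<lambda>x. a * exp (c * x))" for a
  proof (rule smooth_coinduct[where P="\<lambda>f. \<exists>a. f = (\<lambda>x. a * exp (c * x))"])
    fix f :: "real \<Rightarrow> real" assume "\<exists>a. f = (\<lambda>x. a * exp (c * x))"
    then obtain a where f: "f = (\<lambda>x. a * exp (c * x))" by blast
    have "\<forall>x. (f has_real_derivative (a * c) * exp (c * x)) (at x)"
      unfolding f by (auto intro!: derivative_eq_intros)
    then show "\<exists>f'. (\<exists>a. f' = (\<lambda>x. a * exp (c * x))) \<and>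
        (\<forall>x. (f has_real_derivative f' x) (at x))" by blast
  qed blast
  from this[of 1] show ?thesis by simp
qed

lemma smooth_affine_comp:
  assumes "smooth f" shows "smooth (\<lambda>x. f (c * x + d))"
proof -
  have "times_differentiable n f \<Longrightarrow> times_differentiable n (\<lambda>x. f (c * x + d))" for n f
  proof (induction n arbitrary: f)
    case (Suc n)
    then obtain f' where f': "\<And>x. (f has_real_derivative f' x) (at x)" "times_differentiable n f'"
      by auto
    have "((\<lambda>x. f (c * x + d)) has_real_derivative f' (c * x + d) * c) (at x)" for x
      by (rule DERIV_chain2[OF f'(1)]) (auto intro!: derivative_eq_intros)
    moreover have "times_differentiable n (\<lambda>x. f' (c * x + d) * c)"
      using times_differentiable_mult[OF Suc.IH[OF f'(2)], of "\<lambda>_. c"] smooth_const[of c]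
      by (simp add: smooth_def)
    ultimately show ?case
      by (auto intro!: exI[of _ "\<lambda>x. f' (c * x + d) * c"])
  qed simp
  with assms show ?thesis by (simp add: smooth_def)
qed

lemma smooth_DERIV: "smooth f \<Longrightarrow> (f has_real_derivative deriv f x) (at x)"
  unfolding smooth_def by (metis DERIV_imp_deriv times_differentiable.simps(2))

lemma smooth_deriv:
  assumes "smooth f" shows "smooth (deriv f)"
  unfolding smooth_def
proof
  fix n
  from assms obtain f' where "\<forall>x. (f has_real_derivative f' x) (at x)" "times_differentiable n f'"
    unfolding smooth_def by (metis times_differentiable.simps(2))
  moreover from this have "f' = deriv f" by (metis DERIV_imp_deriv ext)
  ultimately show "times_differentiable n (deriv f)" by simp
qed

lemma smooth_DERIV_cong:
  assumes "smooth f" "\<And>x. (f has_real_derivative f' x) (at x)" shows "smooth f'"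
proof -
  have "f' = deriv f" using assms(2) by (metis DERIV_imp_deriv ext)
  with smooth_deriv[OF assms(1)] show ?thesis by simp
qed

lemma smooth_funpow_deriv: "smooth f \<Longrightarrow> smooth ((deriv ^^ n) f)"
  by (induction n) (auto intro: smooth_deriv)

lemma smooth_continuous_on: "smooth f \<Longrightarrow> continuous_on S f"
  by (meson DERIV_isCont continuous_at_imp_continuous_on smooth_DERIV)

text \<open>The classical function exp (-1/x), flat at 0, with a polynomial in t = 1/x as factor:
  this makes the family closed under differentiation. All cutoffs are built from
  \<open>bump [:1:]\<close>.\<close>

definition bump :: "real poly \<Rightarrow> real \<Rightarrow> real"
  where "bump P x = (if 0 < x then poly P (1 / x) * exp (- (1 / x)) else 0)"

lemma poly_times_exp_tendsto_0: "((\<lambda>t. poly P t * exp (- t)) \<longlongrightarrow> 0) (at_top :: real filter)"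
proof -
  have "((\<lambda>t. \<Sum>i\<le>degree P. coeff P i * (t ^ i / exp t)) \<longlongrightarrow> (\<Sum>i\<le>degree P. coeff P i * 0)) at_top"
    by (intro tendsto_intros tendsto_power_div_exp_0)
  then show ?thesis
    by (simp add: poly_altdef sum_distrib_right exp_minus divide_inverse mult.assoc)
qed

text \<open>Since dt/dx = -t^2, the derivative of P(t) exp (-t) is t^2 (P - P')(t) exp (-t), and
  \<open>[:0, 0, 1:]\<close> is t^2. At 0 the right difference quotient is t P(t) exp (-t) with t
  tending to infinity.\<close>

lemma bump_has_derivative:
  "(bump P has_real_derivative bump ([:0, 0, 1:] * (P - pderiv P)) x) (at x)"
proof -
  let ?Q = "[:0, 0, 1:] * (P - pderiv P)"
  consider "x < 0" | "x > 0" | "x = 0" by linarith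
  then show ?thesis
  proof cases
    case 1
    have "((\<lambda>_. 0) has_real_derivative bump ?Q x) (at x)" using 1 by (simp add: bump_def)
    then show ?thesis
      by (rule has_field_derivative_transform_within_open[of _ _ _ "{..<0}"]) (use 1 in \<open>auto simp: bump_def\<close>)
  next
    case 2
    have "((\<lambda>x. poly P (1 / x) * exp (- (1 / x))) has_real_derivative bump ?Q x) (at x)"
      using 2 by (auto simp: bump_def field_simps power2_eq_square intro!: derivative_eq_intros DERIV_chain2[OF poly_DERIV])
    then show ?thesis
      by (rule has_field_derivative_transform_within_open[of _ _ _ "{0<..}"]) (use 2 in \<open>auto simp: bump_def\<close>)
  next
    case 3
    have "((\<lambda>h. bump P h / h) \<longlongrightarrow> 0) (at_right 0)"
    proof -
      have "((\<lambda>t. poly ([:0, 1:] * P) t * exp (- t)) \<longlongrightarrow> 0) (at_top :: real filter)"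
        by (rule poly_times_exp_tendsto_0)
      then have "((\<lambda>h. poly ([:0, 1:] * P) (inverse h) * exp (- inverse h)) \<longlongrightarrow> 0) (at_right (0::real))"
        by (rule filterlim_compose[OF _ filterlim_inverse_at_top_right])
      then show ?thesis
        by (rule Lim_transform_eventually)
          (auto simp: eventually_at_filter bump_def field_simps)
    qed
    moreover have "((\<lambda>h. bump P h / h) \<longlongrightarrow> 0) (at_left 0)"
      by (rule tendsto_eventually) (auto simp: eventually_at_filter bump_def)
    ultimately have "((\<lambda>h. bump P h / h) \<longlongrightarrow> 0) (at 0)"
      by (simp add: filterlim_split_at)
    then show ?thesis using 3 by (simp add: DERIV_def bump_def)
  qed
qed

lemma smooth_bump: "smooth (bump P)"
  by (rule smooth_coinduct[where P="\<lambda>f. \<exists>P. f = bump P"]) (use bump_has_derivative in blast)+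

lemma bump_nonpos [simp]: "x \<le> 0 \<Longrightarrow> bump P x = 0"
  by (simp add: bump_def)

text \<open>A single term of the exponential series gives t^i exp (-t) <= i! for t >= 0.\<close>

lemma bump_bounded: "\<exists>C. \<forall>x. \<bar>bump P x\<bar> \<le> C"
proof -
  have *: "t ^ i * exp (- t) \<le> fact i" if "0 \<le> t" for t :: real and i
  proof -
    have "t ^ i / fact i \<le> exp t"
      using sum_le_suminf[OF summable_exp[of t], of "{i}"] that
      by (simp add: exp_def divide_inverse mult.commute)
    then show ?thesis by (simp add: exp_minus field_simps)
  qed
  have "\<bar>bump P x\<bar> \<le> (\<Sum>i\<le>degree P. \<bar>coeff P i\<bar> * fact i)" for x
  proof (cases "0 < x")
    case True
    have "\<bar>bump P x\<bar> = \<bar>\<Sum>i\<le>degree P. coeff P i * ((1 / x) ^ i * exp (- (1 / x)))\<bar>"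
      using True by (simp add: bump_def poly_altdef sum_distrib_right mult.assoc)
    also have "\<dots> \<le> (\<Sum>i\<le>degree P. \<bar>coeff P i * ((1 / x) ^ i * exp (- (1 / x)))\<bar>)"
      by (rule sum_abs)
    also have "\<dots> \<le> (\<Sum>i\<le>degree P. \<bar>coeff P i\<bar> * fact i)"
      using True *[of "1/x"] by (intro sum_mono) (simp add: abs_mult mult_left_mono)
    finally show ?thesis .
  qed (auto intro!: sum_nonneg)
  then show ?thesis by blast
qed

text \<open>As x grows, t = 1/x tends to 0 and only the constant coefficient survives. Hence
  \<open>bump [:1:]\<close> tends to 1 and its derivatives, whose polynomials are multiples of t^2,
  tend to 0.\<close>

lemma bump_tendsto: "(bump P \<longlongrightarrow> coeff P 0) at_top"
proof -
  have "((\<lambda>x. poly P (1 / x) * exp (- (1 / x))) \<longlongrightarrow> poly P 0 * exp (- 0)) at_top"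
    by (intro tendsto_intros tendsto_compose[OF isCont_tendsto_compose[OF poly_isCont]] real_tendsto_divide_at_top[OF tendsto_const] filterlim_ident)
  then show ?thesis
    by (auto simp: bump_def poly_0_coeff_0 elim!: Lim_transform_eventually intro!: eventually_mono[OF eventually_gt_at_top[of 0]])
qed

section \<open>Products of functions of one variable as test functions in the plane\<close>

lemma smooth_upto_prod:
  assumes a: "smooth a" and b: "smooth b"
  shows "smooth_upto \<Omega> (\<lambda>z :: real \<times> real. a (fst z) * b (snd z))"
proof -
  \<comment> \<open>For a product the order of differentiation is irrelevant, so only the number of
    occurrences of each basis vector in \<open>bs\<close> matters.\<close>
  define D :: "(real \<times> real) list \<Rightarrow> real \<times> real \<Rightarrow> real" where "D bs = (\<lambda>z :: real \<times> real. (deriv ^^ count_list bs (1, 0)) a (fst z) *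
    (deriv ^^ count_list bs (0, 1)) b (snd z))" for bs
  have B: "(Basis :: (real \<times> real) set) = {(1, 0), (0, 1)}" by (auto simp: Basis_prod_def)
  have "continuous_on S (D bs)" for bs S
    unfolding D_def
    by (intro continuous_intros continuous_on_compose2[OF smooth_continuous_on[OF smooth_funpow_deriv[OF a], of UNIV]]
       continuous_on_compose2[OF smooth_continuous_on[OF smooth_funpow_deriv[OF b], of UNIV]]) auto
  moreover have "GDERIV (D bs) z :> (\<Sum>e\<in>Basis. D (e # bs) z *\<^sub>R e)" for bs and z :: "real \<times> real"
  proof -
    let ?A = "(deriv ^^ count_list bs (1, 0)) a" and ?B = "(deriv ^^ count_list bs (0, 1)) b"
    note dA = smooth_DERIV[OF smooth_funpow_deriv[OF a, of "count_list bs (1, 0)"], of "fst z", unfolded has_field_derivative_def]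
    note dB = smooth_DERIV[OF smooth_funpow_deriv[OF b, of "count_list bs (0, 1)"], of "snd z", unfolded has_field_derivative_def]
    have "((\<lambda>z. ?A (fst z)) has_derivative (\<lambda>h. deriv ?A (fst z) * fst h)) (at z)"
      by (rule has_derivative_compose[OF has_derivative_fst[OF has_derivative_ident] dA])
    moreover have "((\<lambda>z. ?B (snd z)) has_derivative (\<lambda>h. deriv ?B (snd z) * snd h)) (at z)"
      by (rule has_derivative_compose[OF has_derivative_snd[OF has_derivative_ident] dB])
    ultimately show ?thesis
      unfolding gderiv_def D_def
      by (auto simp: B inner_prod_def algebra_simps fun_eq_iff intro!: derivative_eq_intros)
  qed
  ultimately show ?thesis
    unfolding smooth_upto_def by (intro exI[of _ D]) (auto simp: D_def)
qed

lemma gradient_eqI: "(f has_derivative (\<lambda>h. h \<bullet> v)) (at z) \<Longrightarrow> gradient f z = v"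
  unfolding gradient_def by (metis (no_types, lifting) euclidean_representation frechet_derivative_at inner_commute sum.cong)

lemma gradient_prod:
  assumes "(a has_real_derivative a') (at (fst z))" "(b has_real_derivative b') (at (snd z))"
  shows "gradient (\<lambda>z :: real \<times> real. a (fst z) * b (snd z)) z = (a' * b (snd z), a (fst z) * b')"
proof (rule gradient_eqI)
  have "((\<lambda>z. a (fst z)) has_derivative (\<lambda>h. a' * fst h)) (at z)"
    by (rule has_derivative_compose[OF has_derivative_fst[OF has_derivative_ident] assms(1)[unfolded has_field_derivative_def]])
  moreover have "((\<lambda>z. b (snd z)) has_derivative (\<lambda>h. b' * snd h)) (at z)"
    by (rule has_derivative_compose[OF has_derivative_snd[OF has_derivative_ident] assms(2)[unfolded has_field_derivative_def]])
  ultimately show "((\<lambda>z. a (fst z) * b (snd z)) has_derivative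
     (\<lambda>h. h \<bullet> (a' * b (snd z), a (fst z) * b'))) (at z)"
    by (auto simp: inner_prod_def algebra_simps fun_eq_iff intro!: derivative_eq_intros)
qed

lemma test_functions_prod:
  assumes "smooth a" "smooth b"
    and "\<And>x. x \<notin> {l..r} \<Longrightarrow> a x = 0" "\<And>y. y \<notin> {c..d} \<Longrightarrow> b y = 0" "{l..r} \<times> {c..d} \<subseteq> \<Omega>"
  shows "(\<lambda>z :: real \<times> real. a (fst z) * b (snd z)) \<in> test_functions \<Omega>"
proof -
  let ?N = "{z :: real \<times> real. a (fst z) * b (snd z) \<noteq> 0}"
  have "?N \<subseteq> {l..r} \<times> {c..d}" using assms(3,4) by force
  moreover have "closed ({l..r} \<times> {c..d})" by (intro closed_Times) auto
  ultimately have *: "closure ?N \<subseteq> {l..r} \<times> {c..d}" by (rule closure_minimal)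
  moreover have "compact ({l..r} \<times> {c..d})" by (intro compact_Times) auto
  ultimately have "compact (closure ?N)"
    by (meson bounded_subset compact_eq_bounded_closed closed_closure)
  with * assms(5) smooth_upto_prod[OF assms(1,2)] show ?thesis
    by (auto simp: test_functions_def)
qed

section \<open>Completeness by moments\<close>

text \<open>The positive and the negative part of \<open>F\<close>, read as densities
  (\<open>ennreal\<close> cuts off negative values), have equal finite mass on every half-line,
  hence define the same measure. The two parts are never both nonzero at a point, so both
  vanish.\<close>

lemma AE_zero_if_halfline_integrals_zero:
  fixes F :: "real \<Rightarrow> real"
  assumes F [measurable]: "integrable lborel F"
    and zero: "\<And>s. (\<integral>x. F x * indicator {s<..} x \<partial>lborel) = 0"
  shows "AE x in lborel. F x = 0"
proof -
  let ?M = "density lborel (\<lambda>x. ennreal (F x))" and ?N = "density lborel (\<lambda>x. ennreal (- F x))"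
  have eq: "emeasure ?M {s<..} = emeasure ?N {s<..} \<and> emeasure ?M {s<..} < \<infinity>" for s
  proof -
    let ?f = "\<lambda>x. F x * indicator {s<..} x"
    have f: "integrable lborel ?f" by (intro integrable_real_mult_indicator F) auto
    have M: "emeasure ?M {s<..} = (\<integral>\<^sup>+x. ennreal (?f x) \<partial>lborel)"
      by (subst emeasure_density) (auto intro!: nn_integral_cong simp: indicator_def)
    have N: "emeasure ?N {s<..} = (\<integral>\<^sup>+x. ennreal (- ?f x) \<partial>lborel)"
      by (subst emeasure_density) (auto intro!: nn_integral_cong simp: indicator_def)
    have fin: "(\<integral>\<^sup>+x. ennreal (?f x) \<partial>lborel) \<noteq> \<infinity>" "(\<integral>\<^sup>+x. ennreal (- ?f x) \<partial>lborel) \<noteq> \<infinity>"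
      using f by (auto simp: real_integrable_def)
    have "enn2real (\<integral>\<^sup>+x. ennreal (?f x) \<partial>lborel) = enn2real (\<integral>\<^sup>+x. ennreal (- ?f x) \<partial>lborel)"
      using real_lebesgue_integral_def[OF f] zero[of s] by simp
    with fin have "(\<integral>\<^sup>+x. ennreal (?f x) \<partial>lborel) = (\<integral>\<^sup>+x. ennreal (- ?f x) \<partial>lborel)"
      by (auto simp: less_top dest!: arg_cong[of _ _ ennreal])
    with M N fin show ?thesis by (simp add: less_top)
  qed
  have "?M = ?N"
  proof (rule measure_eqI_lessThan)
    show "emeasure ?M {s<..} < \<infinity>" "emeasure ?M {s<..} = emeasure ?N {s<..}" for s
      using eq[of s] by blast+
  qed simp_all
  then have "AE x in lborel. ennreal (F x) = ennreal (- F x)"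
    by (intro sigma_finite_measure.density_unique[OF sigma_finite_lborel]) auto
  then show ?thesis
  proof eventually_elim
    case (elim x)
    then show ?case by (cases "0 \<le> F x") (auto simp: ennreal_neg)
  qed
qed

text \<open>The last assumption says that \<open>c\<close> is strictly decreasing on \<open>I\<close>, in the form needed for
  half-lines whose end point lies outside \<open>I\<close>.\<close>

lemma AE_zero_if_moments_zero:
  fixes F c :: "real \<Rightarrow> real"
  assumes F [measurable]: "integrable lborel F" and c [measurable]: "c \<in> borel_measurable borel"
    and supp: "\<And>x. x \<notin> I \<Longrightarrow> F x = 0"
    and bound: "\<And>x. x \<in> I \<Longrightarrow> \<bar>c x\<bar> \<le> 1"
    and moments: "\<And>j. (\<integral>x. F x * c x ^ j \<partial>lborel) = 0"
    and decreasing: "\<And>s. \<exists>t. \<forall>x\<in>I. s < x \<longleftrightarrow> c x < t"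
  shows "AE x in lborel. F x = 0"
proof (rule AE_zero_if_halfline_integrals_zero[OF F])
  let ?N = "\<integral>x. \<bar>F x\<bar> \<partial>lborel"
  \<comment> \<open>Vanishing moments pass from polynomials in \<open>c\<close> to continuous
    functions of \<open>c\<close> by uniform approximation on [-1, 1], which contains the values of
    \<open>c\<close> on \<open>I\<close>.\<close>
  have cont: "(\<integral>x. F x * q (c x) \<partial>lborel) = 0" if q: "continuous_on UNIV q" for q :: "real \<Rightarrow> real"
  proof (rule ccontr)
    let ?I = "\<integral>x. F x * q (c x) \<partial>lborel"
    assume "?I \<noteq> 0"
    \<comment> \<open>Chosen so that the error bound e times \<open>?N\<close> stays strictly below
      the absolute value of \<open>?I\<close>; the summand 1 also keeps the denominator
      positive.\<close>
    define e where "e = \<bar>?I\<bar> / (?N + 1)"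
    have "0 \<le> ?N" by simp
    with \<open>?I \<noteq> 0\<close> have "0 < e" unfolding e_def by (intro divide_pos_pos) linarith+
    from Stone_Weierstrass_real_polynomial_function[OF compact_Icc continuous_on_subset[OF q] \<open>0 < e\<close>, of "-1" 1]
    obtain g where g: "real_polynomial_function g" "\<And>x. x \<in> {-1..1} \<Longrightarrow> \<bar>q x - g x\<bar> < e" by auto
    from g(1) obtain a n where ga: "g = (\<lambda>x. \<Sum>i\<le>n. a i * x ^ i)"
      by (auto simp: real_polynomial_function_iff_sum)
    have [measurable]: "q \<in> borel_measurable borel" using q by (rule borel_measurable_continuous_onI)
    have ipow: "integrable lborel (\<lambda>x. F x * c x ^ i)" for i
    proof (rule Bochner_Integration.integrable_bound[OF F])
      show "AE x in lborel. norm (F x * c x ^ i) \<le> norm (F x)"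
      proof (rule AE_I2)
        fix x show "norm (F x * c x ^ i) \<le> norm (F x)"
          using bound[of x] supp[of x]
          by (cases "x \<in> I") (auto simp: abs_mult power_abs intro!: mult_left_le power_le_one)
      qed
    qed simp
    have eqg: "F x * g (c x) = (\<Sum>i\<le>n. a i * (F x * c x ^ i))" for x
      by (simp add: ga sum_distrib_left mult_ac)
    have ig: "integrable lborel (\<lambda>x. F x * g (c x))"
      unfolding eqg by (intro Bochner_Integration.integrable_sum integrable_mult_right ipow)
    have "(\<integral>x. F x * g (c x) \<partial>lborel) = (\<integral>x. (\<Sum>i\<le>n. a i * (F x * c x ^ i)) \<partial>lborel)"
      by (simp only: eqg)
    also have "\<dots> = 0"
      by (subst Bochner_Integration.integral_sum) (auto simp: ipow moments)
    finally have g0: "(\<integral>x. F x * g (c x) \<partial>lborel) = 0" .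
    have bd: "\<bar>F x * q (c x) - F x * g (c x)\<bar> \<le> e * \<bar>F x\<bar>" for x
      using bound[of x] supp[of x] g(2)[of "c x"]
      by (cases "x \<in> I") (auto simp: right_diff_distrib[symmetric] abs_mult mult.commute[of e] abs_le_iff intro!: mult_left_mono)
    have [measurable]: "g \<in> borel_measurable borel" unfolding ga by measurable
    have id: "integrable lborel (\<lambda>x. F x * q (c x) - F x * g (c x))"
      by (rule Bochner_Integration.integrable_bound[of _ "\<lambda>x. e * \<bar>F x\<bar>"])
        (use bd F \<open>0 < e\<close> in \<open>auto simp: abs_mult\<close>)
    have "?I = (\<integral>x. F x * q (c x) - F x * g (c x) \<partial>lborel)"
      using Bochner_Integration.integral_add[OF id ig] g0 by simp
    also have "\<bar>\<dots>\<bar> \<le> (\<integral>x. e * \<bar>F x\<bar> \<partial>lborel)"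
      using integral_abs_bound id F bd by (intro order_trans[OF integral_abs_bound] integral_mono) auto
    also have "\<dots> = e * ?N" by simp
    also have "\<dots> < e * (?N + 1)" using \<open>0 < e\<close> by simp
    also have "\<dots> = \<bar>?I\<bar>" unfolding e_def by (rule nonzero_eq_divide_eq[THEN iffD1, OF _ refl]) (use \<open>0 \<le> ?N\<close> in linarith)
    finally show False by simp
  qed
  fix s
  obtain t where t: "\<And>x. x \<in> I \<Longrightarrow> s < x \<longleftrightarrow> c x < t" using decreasing[of s] by blast
  \<comment> \<open>Continuous ramps increasing to the indicator of r < t; composed with
    \<open>c\<close> they converge on \<open>I\<close> to the indicator of s < x.\<close>
  define q where "q k r = min 1 (max 0 (real k * (t - r)))" for k r
  have q [measurable]: "q k \<in> borel_measurable borel" for k unfolding q_def by measurable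
  have lim: "(\<lambda>k. q k r) \<longlonglongrightarrow> (if r < t then 1 else 0)" for r
  proof (cases "r < t")
    case True
    then obtain k0 where "1 \<le> real k0 * (t - r)"
      by (metis diff_gt_0_iff_gt less_imp_le reals_Archimedean3)
    then have "\<forall>\<^sub>F k in sequentially. q k r = 1"
      using True
      by (intro eventually_sequentiallyI[of k0])
        (auto simp: q_def min_def max_def intro: order_trans mult_right_mono)
    with True show ?thesis by (simp add: tendsto_eventually)
  next
    case False
    then have "q k r = 0" for k by (auto simp: q_def max_def min_def mult_le_0_iff zero_le_mult_iff not_less)
    with False show ?thesis by simp
  qed
  have "(\<lambda>k. \<integral>x. F x * q k (c x) \<partial>lborel) \<longlonglongrightarrow> (\<integral>x. F x * indicator {s<..} x \<partial>lborel)"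
  proof (rule integral_dominated_convergence[where w = "\<lambda>x. \<bar>F x\<bar>"])
    show "AE x in lborel. (\<lambda>k. F x * q k (c x)) \<longlonglongrightarrow> F x * indicator {s<..} x"
    proof (rule AE_I2)
      fix x show "(\<lambda>k. F x * q k (c x)) \<longlonglongrightarrow> F x * indicator {s<..} x"
        using tendsto_mult_left[OF lim[of "c x"], of "F x"] t[of x] supp[of x]
        by (cases "x \<in> I") (auto simp: indicator_def)
    qed
    show "AE x in lborel. norm (F x * q k (c x)) \<le> \<bar>F x\<bar>" for k
      by (auto simp: abs_mult q_def intro!: mult_left_le)
  qed (use F in auto)
  moreover have "(\<integral>x. F x * q k (c x) \<partial>lborel) = 0" for k
    by (rule cont) (auto simp: q_def intro!: continuous_intros)
  ultimately show "(\<integral>x. F x * indicator {s<..} x \<partial>lborel) = 0"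
    by (simp add: LIMSEQ_const_iff)
qed

text \<open>The right half is reflected onto the left one, and the midpoint is a null set. With
  \<open>r = pi\<close> this reduces (0, 2 pi), where cosine is not injective, to (0, pi), where it
  is.\<close>

lemma integral_fold_interval:
  fixes F :: "real \<Rightarrow> real"
  assumes F: "integrable lborel F" and supp: "\<And>x. x \<notin> {0<..<2 * r} \<Longrightarrow> F x = 0"
  shows "integrable lborel (\<lambda>x. indicator {0<..<r} x * (F x + F (2 * r - x)))"
    and "(\<integral>x. F x \<partial>lborel) = (\<integral>x. indicator {0<..<r} x * (F x + F (2 * r - x)) \<partial>lborel)"
proof -
  have [measurable]: "F \<in> borel_measurable borel" using F by simp
  let ?L = "\<lambda>x. indicator {0<..<r} x * F x" and ?R = "\<lambda>x. indicator {r<..<2 * r} x * F x"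
  have L: "integrable lborel ?L" and R: "integrable lborel ?R"
    using integrable_real_mult_indicator[OF _ F] by (auto simp: mult.commute)
  have refl: "indicator {r<..<2 * r} (2 * r + -1 * x) = (indicator {0<..<r} x :: real)" for x
    by (auto simp: indicator_def)
  have R': "integrable lborel (\<lambda>x. indicator {0<..<r} x * F (2 * r - x))"
    using lborel_integrable_real_affine[OF R, of "-1" "2 * r"] unfolding refl by simp
  have "(\<integral>x. ?R x \<partial>lborel) = (\<integral>x. indicator {0<..<r} x * F (2 * r - x) \<partial>lborel)"
    using lborel_integral_real_affine[of "-1" ?R "2 * r"] unfolding refl by simp
  moreover have "(\<integral>x. F x \<partial>lborel) = (\<integral>x. ?L x + ?R x \<partial>lborel)"
  proof (rule integral_cong_AE)
    have "AE x in lborel. x \<noteq> r" by (rule AE_lborel_singleton)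
    then show "AE x in lborel. F x = ?L x + ?R x"
      by eventually_elim (use supp in \<open>auto simp: indicator_def not_less\<close>)
  qed auto
  ultimately show "(\<integral>x. F x \<partial>lborel) = (\<integral>x. indicator {0<..<r} x * (F x + F (2 * r - x)) \<partial>lborel)"
    by (simp add: L R R' distrib_left)
  show "integrable lborel (\<lambda>x. indicator {0<..<r} x * (F x + F (2 * r - x)))"
    using Bochner_Integration.integrable_add[OF L R'] by (simp add: distrib_left)
qed

text \<open>The bound is asked for only where \<open>F\<close> is nonzero, so that the support of
  \<open>F\<close> can tame unbounded factors such as 2 pi - x.\<close>

lemma integrable_mult_bounded:
  fixes F \<psi> :: "'a \<Rightarrow> real"
  assumes "integrable M F" "\<psi> \<in> borel_measurable M" "\<And>x. x \<in> space M \<Longrightarrow> F x \<noteq> 0 \<Longrightarrow> \<bar>\<psi> x\<bar> \<le> C"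
  shows "integrable M (\<lambda>x. F x * \<psi> x)"
proof (rule Bochner_Integration.integrable_bound[of _ "\<lambda>x. C * F x"])
  show "AE x in M. norm (F x * \<psi> x) \<le> norm (C * F x)"
  proof (rule AE_I2)
    fix x assume "x \<in> space M"
    show "norm (F x * \<psi> x) \<le> norm (C * F x)"
    proof (cases "F x = 0")
      case False
      with assms(3)[OF \<open>x \<in> space M\<close>] have "\<bar>\<psi> x\<bar> \<le> \<bar>C\<bar>" by linarith
      then show ?thesis by (simp add: abs_mult mult.commute[of "\<bar>C\<bar>"] mult_left_mono)
    qed simp
  qed
qed (use assms in auto)

lemma cos_less_iff_threshold: "\<exists>t. \<forall>x\<in>{0<..<pi}. s < x \<longleftrightarrow> cos x < t"
proof -
  consider "s \<le> 0" | "pi \<le> s" | "0 < s" "s < pi" by linarith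
  then show ?thesis
  proof cases
    case 1
    have "cos x < 1" if "0 < x" "x < pi" for x
      using cos_monotone_0_pi[of 0 x] that by auto
    with 1 show ?thesis by (intro exI[of _ 1]) auto
  next
    case 2 then show ?thesis by (intro exI[of _ "-1"]) (auto simp: not_less)
  next
    case 3 then show ?thesis
      by (intro exI[of _ "cos s"]) (auto simp: cos_mono_less_eq)
  qed
qed

text \<open>The functions \<open>sin (m x)\<close>, \<open>(2\<pi> - x) cos (m x)\<close> are the root functions of the adjoint
  problem. Orthogonality to the sines makes \<open>g\<close> even about \<open>\<pi>\<close>; orthogonality to the others makes
  \<open>(2\<pi> - x) g x\<close> odd about \<open>\<pi>\<close>.\<close>

lemma root_functions_complete:
  fixes g :: "real \<Rightarrow> real"
  assumes g: "integrable lborel g" and supp: "\<And>x. x \<notin> {0<..<2 * pi} \<Longrightarrow> g x = 0"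
    and s: "\<And>m::nat. (\<integral>x. g x * sin (m * x) \<partial>lborel) = 0"
    and c: "\<And>m::nat. (\<integral>x. g x * ((2 * pi - x) * cos (m * x)) \<partial>lborel) = 0"
  shows "AE x in lborel. g x = 0"
proof -
  have [measurable]: "g \<in> borel_measurable borel" using g by simp
  have isin: "integrable lborel (\<lambda>x. g x * (sin (m * x) * cos x ^ j))" for j m
    by (rule integrable_mult_bounded[OF g, of _ 1])
      (auto simp: abs_mult power_abs intro!: mult_le_one power_le_one)
  have ic: "integrable lborel (\<lambda>x. g x * ((2 * pi - x) * cos (m * x) * cos x ^ j))" for j m
  proof (rule integrable_mult_bounded[OF g, of _ "2 * pi"])
    fix x assume "g x \<noteq> 0"
    with supp[of x] have "\<bar>2 * pi - x\<bar> \<le> 2 * pi" by force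
    moreover have "\<bar>cos (m * x) * cos x ^ j\<bar> \<le> 1"
      by (auto simp: abs_mult power_abs intro!: mult_le_one power_le_one)
    ultimately have "\<bar>2 * pi - x\<bar> * \<bar>cos (m * x) * cos x ^ j\<bar> \<le> 2 * pi * 1"
      by (intro mult_mono) auto
    then show "\<bar>(2 * pi - x) * cos (m * x) * cos x ^ j\<bar> \<le> 2 * pi"
      by (simp add: abs_mult mult.assoc)
  qed auto
  \<comment> \<open>Induction on \<open>j\<close> by sin (m x) cos x = (sin ((m+1) x) + sin ((m-1)
    x)) / 2. As m - 1 may become negative, \<open>m\<close> ranges over the integers; oddness of
    sine covers the negative ones.\<close>
  have s': "(\<integral>x. g x * (sin (of_int m * x) * cos x ^ j) \<partial>lborel) = 0" for j and m :: int
  proof (induction j arbitrary: m)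
    case 0
    show ?case
    proof (cases "0 \<le> m")
      case True with s[of "nat m"] show ?thesis by simp
    next
      case False
      with s[of "nat (- m)"] show ?thesis by simp
    qed
  next
    case (Suc j)
    have "sin (of_int m * x) * cos x =
        (sin (of_int (m + 1) * x) + sin (of_int (m - 1) * x)) / 2" for x :: real
      by (simp add: sin_add sin_diff algebra_simps)
    note e = this
    have "g x * (sin (of_int m * x) * cos x ^ Suc j) =
        (g x * (sin (of_int (m + 1) * x) * cos x ^ j) +
         g x * (sin (of_int (m - 1) * x) * cos x ^ j)) / 2" for x :: real
    proof -
      have "g x * (sin (of_int m * x) * cos x ^ Suc j) = g x * (sin (of_int m * x) * cos x) * cos x ^ j"
        by simp
      then show ?thesis unfolding e by (simp only: distrib_left distrib_right times_divide_eq_left times_divide_eq_right mult.assoc)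
    qed
    then have "(\<integral>x. g x * (sin (of_int m * x) * cos x ^ Suc j) \<partial>lborel) =
        (\<integral>x. (g x * (sin (of_int (m + 1) * x) * cos x ^ j) +
         g x * (sin (of_int (m - 1) * x) * cos x ^ j)) / 2 \<partial>lborel)"
      by presburger
    also have "\<dots> = 0"
      using Suc.IH by (simp only: integral_divide_zero Bochner_Integration.integral_add[OF isin isin]) simp
    finally show ?case .
  qed
  have c': "(\<integral>x. g x * ((2 * pi - x) * cos (of_int m * x) * cos x ^ j) \<partial>lborel) = 0" for j and m :: int
  proof (induction j arbitrary: m)
    case 0
    show ?case
    proof (cases "0 \<le> m")
      case True with c[of "nat m"] show ?thesis by simp
    next
      case False
      with c[of "nat (- m)"] show ?thesis by simp
    qed
  next
    case (Suc j)
    have "cos (of_int m * x) * cos x =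
        (cos (of_int (m + 1) * x) + cos (of_int (m - 1) * x)) / 2" for x :: real
      by (simp add: cos_add cos_diff algebra_simps)
    note e = this
    have "g x * ((2 * pi - x) * cos (of_int m * x) * cos x ^ Suc j) =
        (g x * ((2 * pi - x) * cos (of_int (m + 1) * x) * cos x ^ j) +
         g x * ((2 * pi - x) * cos (of_int (m - 1) * x) * cos x ^ j)) / 2" for x :: real
    proof -
      have "g x * ((2 * pi - x) * cos (of_int m * x) * cos x ^ Suc j)
          = g x * ((2 * pi - x) * ((cos (of_int m * x) * cos x) * cos x ^ j))"
        by simp
      then show ?thesis unfolding e by (simp only: distrib_left distrib_right times_divide_eq_left times_divide_eq_right mult.assoc)
    qed
    then have "(\<integral>x. g x * ((2 * pi - x) * cos (of_int m * x) * cos x ^ Suc j) \<partial>lborel) =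
        (\<integral>x. (g x * ((2 * pi - x) * cos (of_int (m + 1) * x) * cos x ^ j) +
         g x * ((2 * pi - x) * cos (of_int (m - 1) * x) * cos x ^ j)) / 2 \<partial>lborel)"
      by presburger
    also have "\<dots> = 0"
      using Suc.IH by (simp only: integral_divide_zero Bochner_Integration.integral_add[OF ic ic]) simp
    finally show ?case .
  qed
  \<comment> \<open>As cos (2 pi - x) = cos x, the cosine moments of \<open>F\<close> are those of
    the folded function, and cosine is strictly decreasing on (0, pi).\<close>
  have half: "AE x in lborel. indicator {0<..<pi} x * (F x + F (2 * pi - x)) = 0"
    if F: "integrable lborel F" and supp: "\<And>x. x \<notin> {0<..<2 * pi} \<Longrightarrow> F x = 0"
      and moments: "\<And>j. (\<integral>x. F x * cos x ^ j \<partial>lborel) = 0" for F :: "real \<Rightarrow> real"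
  proof (rule AE_zero_if_moments_zero[where c = cos and I = "{0<..<pi}"])
    show "integrable lborel (\<lambda>x. indicator {0<..<pi} x * (F x + F (2 * pi - x)))"
      by (rule integral_fold_interval(1)[OF F supp]) auto
    show "(\<integral>x. indicator {0<..<pi} x * (F x + F (2 * pi - x)) * cos x ^ j \<partial>lborel) = 0" for j
    proof -
      have "integrable lborel (\<lambda>x. F x * cos x ^ j)"
        by (rule integrable_mult_bounded[OF F, of _ 1])
          (auto simp: power_abs intro!: power_le_one)
      from integral_fold_interval(2)[OF this, of pi] supp moments[of j] show ?thesis
        by (simp add: cos_diff ring_distribs mult.assoc)
    qed
  qed (use cos_less_iff_threshold in auto)
  \<comment> \<open>The factor sin x comes from m = 1, the factor 2 pi - x below from m = 0; the
    other frequencies have been absorbed into the powers of cosine.\<close>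
  have "AE x in lborel. indicator {0<..<pi} x * (g x * sin x + g (2 * pi - x) * sin (2 * pi - x)) = 0"
    by (rule half) (use isin[of 1 0] s'[of 1] supp in \<open>auto simp: mult.assoc\<close>)
  moreover have "AE x in lborel. indicator {0<..<pi} x * (g x * (2 * pi - x) + g (2 * pi - x) * (2 * pi - (2 * pi - x))) = 0"
    by (rule half) (use ic[of 0 0] c'[of 0] supp in \<open>auto simp: mult.assoc\<close>)
  \<comment> \<open>Because sin (2 pi - x) = - sin x, the first relation says that g takes equal
    values at x and 2 pi - x; the second then reads 2 pi g(x) = 0.\<close>
  ultimately have "AE x in lborel. indicator {0<..<pi} x * (\<bar>g x\<bar> + \<bar>g (2 * pi - x)\<bar>) = 0"
  proof eventually_elim
    case (elim x)
    show ?case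
    proof (cases "x \<in> {0<..<pi}")
      case True
      then have "sin x \<noteq> 0" using sin_gt_zero[of x] by auto
      with True elim(1) have "g x = g (2 * pi - x)" by (simp add: sin_diff)
      with True elim(2) have "g x * (2 * pi) = 0" by (simp add: algebra_simps)
      with \<open>g x = g (2 * pi - x)\<close> show ?thesis by simp
    qed simp
  qed
  then have "(\<integral>x. indicator {0<..<pi} x * (\<bar>g x\<bar> + \<bar>g (2 * pi - x)\<bar>) \<partial>lborel) = 0"
    by (rule integral_eq_zero_AE)
  then have "(\<integral>x. \<bar>g x\<bar> \<partial>lborel) = 0"
    using integral_fold_interval(2)[of "\<lambda>x. \<bar>g x\<bar>" pi] g supp by simp
  then show ?thesis
    using g by (subst (asm) integral_nonneg_eq_0_iff_AE) auto
qed

section \<open>Weighted integrability on the strip\<close>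

lemma epowr_measurable [measurable]: "(\<lambda>x. x epowr a) \<in> borel_measurable borel"
  unfolding epowr_def by measurable

text \<open>The interval from 0 to 2 pi competes in the supremum. The mean of \<nu> over it is
  positive, because \<nu> vanishes only on a null set, so the finite product forces the dual factor
  to be finite.\<close>

lemma Muckenhoupt_dual_integrable:
  assumes "1 < p" "\<nu> \<in> Muckenhoupt p"
  shows "(\<integral>\<^sup>+ x. \<nu> x epowr (- 1 / (p - 1)) \<partial>lebesgue_on {0<..<2 * pi}) < \<infinity>"
proof -
  let ?w = "\<lambda>x. \<nu> x epowr (- 1 / (p - 1))"
  from assms(2) have meas [measurable]: "\<nu> \<in> borel_measurable lebesgue"
    and null: "\<nu> -` {0, \<infinity>} \<in> null_sets lebesgue"
    and sup: "(SUP (a, b) \<in> {(a, b). a < b}.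
       mean_value a b \<nu> * mean_value a b ?w epowr (p - 1)) < \<infinity>"
    by (auto simp: Muckenhoupt_def)
  have "mean_value 0 (2 * pi) \<nu> * mean_value 0 (2 * pi) ?w epowr (p - 1)
    \<le> (SUP (a, b) \<in> {(a, b). a < b}. mean_value a b \<nu> * mean_value a b ?w epowr (p - 1))"
    by (rule SUP_upper2[of "(0, 2 * pi)"]) auto
  with sup have fin: "mean_value 0 (2 * pi) \<nu> * mean_value 0 (2 * pi) ?w epowr (p - 1) \<noteq> \<infinity>"
    by (auto simp: top_unique)
  have nz: "AE x in lebesgue. \<nu> x \<noteq> 0"
    using AE_not_in[OF null] by eventually_elim auto
  \<comment> \<open>Since 0 times infinity is 0 in \<open>ennreal\<close>, a zero mean could hide an
    infinite dual factor.\<close>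
  have "(\<integral>\<^sup>+ x. \<nu> x \<partial>lebesgue_on {0..2 * pi}) \<noteq> 0"
  proof
    assume "(\<integral>\<^sup>+ x. \<nu> x \<partial>lebesgue_on {0..2 * pi}) = 0"
    then have "AE x in lebesgue_on {0..2 * pi}. \<nu> x = 0"
      by (subst (asm) nn_integral_0_iff_AE) (auto intro: measurable_restrict_space1)
    then have "AE x in lebesgue. x \<in> {0..2 * pi} \<longrightarrow> \<nu> x = 0"
      by (subst (asm) AE_restrict_space_iff) auto
    with nz have "AE x in lebesgue. x \<notin> {0..2 * pi}"
      by eventually_elim auto
    then have "{0..2 * pi} \<in> null_sets lebesgue"
      by (auto simp: AE_iff_null_sets)
    then show False by (simp add: null_sets_def)
  qed
  then have "mean_value 0 (2 * pi) \<nu> \<noteq> 0"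
    by (simp add: mean_value_def ennreal_divide_eq_0_iff)
  with fin have "mean_value 0 (2 * pi) ?w epowr (p - 1) \<noteq> \<infinity>"
    by (auto simp: ennreal_mult_eq_top_iff)
  with assms(1) have "mean_value 0 (2 * pi) ?w \<noteq> \<infinity>"
    by (auto simp: epowr_def split: if_splits)
  then have "(\<integral>\<^sup>+ x. ?w x \<partial>lebesgue_on {0..2 * pi}) \<noteq> \<infinity>"
    by (auto simp: mean_value_def ennreal_divide_eq_top_iff ennreal_top_divide)
  moreover have "(\<integral>\<^sup>+ x. ?w x \<partial>lebesgue_on {0<..<2 * pi}) \<le> (\<integral>\<^sup>+ x. ?w x \<partial>lebesgue_on {0..2 * pi})"
    by (auto simp: nn_integral_restrict_space indicator_def intro!: nn_integral_mono)
  ultimately show ?thesis by (simp add: less_top top_unique)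
qed

text \<open>A substitute for Young's inequality by cases: either t is at most the dual weight
  n^(-1/(p-1)), or t^(p-1) n >= 1 and hence t <= t^p n. The conventions for 0 and infinity keep it
  valid for every \<open>n\<close>.\<close>

lemma le_powr_weight_plus_dual:
  assumes p: "1 < p" and t: "0 \<le> t"
  shows "ennreal t \<le> ennreal (t powr p) * n + n epowr (- 1 / (p - 1))"
proof (cases n)
  case (real r)
  show ?thesis
  proof (cases "r = 0")
    case False
    let ?q = "- 1 / (p - 1)"
    from False real have r: "0 < r" by simp
    have "t \<le> t powr p * r + r powr ?q"
    proof (cases "t \<le> r powr ?q")
      case True
      then show ?thesis using r by (auto intro: add_increasing)
    next
      case False
      then have "(r powr ?q) powr (p - 1) \<le> t powr (p - 1)"
        using p by (intro powr_mono2) auto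
      moreover have "(r powr ?q) powr (p - 1) = r powr (?q * (p - 1))" by (rule powr_powr)
      moreover have "?q * (p - 1) = - 1" using p by simp
      ultimately have "1 / r \<le> t powr (p - 1)"
        using r by (simp only: powr_minus_divide powr_one)
      then have "1 \<le> t powr (p - 1) * r" using r by (simp add: field_simps)
      then have "t * 1 \<le> t * (t powr (p - 1) * r)" using t by (intro mult_left_mono)
      moreover have "t powr p = t * t powr (p - 1)"
        using t p by (cases "t = 0") (auto simp: powr_mult_base)
      moreover have "0 \<le> r powr ?q" by simp
      ultimately show ?thesis by (simp add: mult.assoc add_increasing2)
    qed
    moreover have "n epowr ?q = ennreal (r powr ?q)"
      using r p real by (simp add: epowr_def)
    ultimately show ?thesis
      using r by (simp add: real ennreal_mult[symmetric] ennreal_plus[symmetric] ennreal_leI del: ennreal_plus)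
  qed (use p real in \<open>simp add: epowr_def\<close>)
next
  case top
  then show ?thesis
    using t p by (cases "t = 0") (auto simp: ennreal_mult_top ennreal_eq_0_iff not_le)
qed

text \<open>The pointwise inequality is applied to |g| divided by its norm and integrated, which
  gives 1 plus the dual integral; scaling back yields a constant cruder than that of Hoelder's
  inequality.\<close>

lemma L1_le_Lp_interval_norm:
  assumes p: "1 < p" and \<nu>: "\<nu> \<in> Muckenhoupt p"
    and g [measurable]: "g \<in> borel_measurable (lebesgue_on {0<..<2 * pi})"
  shows "(\<integral>\<^sup>+ x. ennreal \<bar>g x\<bar> \<partial>lebesgue_on {0<..<2 * pi})
    \<le> (1 + (\<integral>\<^sup>+ x. \<nu> x epowr (- 1 / (p - 1)) \<partial>lebesgue_on {0<..<2 * pi})) * Lp_interval_norm p \<nu> g"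
    (is "?L \<le> (1 + ?C) * ?N")
proof -
  let ?I = "lebesgue_on {0<..<2 * pi}"
  let ?A = "\<integral>\<^sup>+ x. ennreal (\<bar>g x\<bar> powr p) * \<nu> x \<partial>?I"
  from \<nu> have \<nu>m: "\<nu> \<in> borel_measurable lebesgue"
    and null: "\<nu> -` {0, \<infinity>} \<in> null_sets lebesgue"
    by (auto simp: Muckenhoupt_def)
  have [measurable]: "\<nu> \<in> borel_measurable ?I"
    using \<nu>m by (rule measurable_restrict_space1)
  have nz: "AE x in lebesgue. \<nu> x \<noteq> 0"
    using AE_not_in[OF null] by eventually_elim auto
  have nz: "AE x in ?I. \<nu> x \<noteq> 0"
    by (subst AE_restrict_space_iff) (use nz in auto)
  have N: "?N = ?A epowr (1 / p)" by (simp add: Lp_interval_norm_def)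
  \<comment> \<open>Normalising requires a norm strictly between 0 and infinity. Norm 0 means that
    \<open>g\<close> vanishes a.e., as \<nu> is nonzero a.e.; for infinite norm the nonzero constant
    \<open>1 + ?C\<close> keeps the right-hand side infinite.\<close>
  show ?thesis
  proof (cases "?A = 0")
    case True
    then have "AE x in ?I. ennreal (\<bar>g x\<bar> powr p) * \<nu> x = 0"
      by (subst (asm) nn_integral_0_iff_AE) auto
    with nz have "AE x in ?I. ennreal \<bar>g x\<bar> = 0"
      by eventually_elim (auto simp: ennreal_eq_0_iff)
    then have "?L = 0" by (subst nn_integral_0_iff_AE) auto
    then show ?thesis by simp
  next
    case nonzero: False
    show ?thesis
    proof (cases "?A = \<infinity>")
      case True
      then have "?N = \<infinity>" using p by (simp add: N epowr_def)
      then show ?thesis by (simp add: ennreal_mult_top)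
    next
      case False
      then obtain \<alpha> where \<alpha>: "?A = ennreal \<alpha>" "0 \<le> \<alpha>" by (cases ?A) auto
      with nonzero have "0 < \<alpha>" by (auto simp: less_le)
      define n where "n = \<alpha> powr (1 / p)"
      have n: "0 < n" "?N = ennreal n"
        using \<open>0 < \<alpha>\<close> \<alpha> p by (auto simp: n_def N epowr_def)
      have np: "n powr p = \<alpha>" using \<open>0 < \<alpha>\<close> p by (simp add: n_def powr_powr)
      have "(\<integral>\<^sup>+ x. ennreal (\<bar>g x\<bar> / n) \<partial>?I) \<le>
         (\<integral>\<^sup>+ x. ennreal ((\<bar>g x\<bar> / n) powr p) * \<nu> x + \<nu> x epowr (- 1 / (p - 1)) \<partial>?I)"
        using n p by (intro nn_integral_mono le_powr_weight_plus_dual) auto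
      also have "\<dots> = (\<integral>\<^sup>+ x. ennreal ((\<bar>g x\<bar> / n) powr p) * \<nu> x \<partial>?I) + ?C"
        by (rule nn_integral_add) auto
      also have "(\<integral>\<^sup>+ x. ennreal ((\<bar>g x\<bar> / n) powr p) * \<nu> x \<partial>?I)
          = (\<integral>\<^sup>+ x. ennreal (1 / \<alpha>) * (ennreal (\<bar>g x\<bar> powr p) * \<nu> x) \<partial>?I)"
        using n \<open>0 < \<alpha>\<close> by (intro nn_integral_cong) (simp add: powr_divide np mult.assoc[symmetric] ennreal_mult[symmetric])
      also have "\<dots> = ennreal (1 / \<alpha>) * ?A"
        by (rule nn_integral_cmult) auto
      also have "\<dots> = 1" using \<open>0 < \<alpha>\<close> by (simp add: \<alpha> ennreal_mult[symmetric])
      finally have le: "(\<integral>\<^sup>+ x. ennreal (\<bar>g x\<bar> / n) \<partial>?I) \<le> 1 + ?C" .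
      have "?L = (\<integral>\<^sup>+ x. ennreal n * ennreal (\<bar>g x\<bar> / n) \<partial>?I)"
        using n by (intro nn_integral_cong) (simp add: ennreal_mult[symmetric])
      also have "\<dots> = ennreal n * (\<integral>\<^sup>+ x. ennreal (\<bar>g x\<bar> / n) \<partial>?I)"
        by (rule nn_integral_cmult) auto
      also have "\<dots> \<le> ennreal n * (1 + ?C)" by (rule mult_left_mono[OF le]) simp
      finally show ?thesis by (simp add: n mult.commute)
    qed
  qed
qed

text \<open>Exchanging the order of the variables requires measurability, which \<open>Q\<close> may
  not have; it is done for a measurable null set \<open>N\<close> containing the exceptional
  points.\<close>

lemma AE_lborel_snd:
  assumes "AE z in (lborel :: (real \<times> real) measure). Q z"
  shows "AE y in lborel. AE x in lborel. Q (x, y)"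
proof -
  have "AE z in lborel \<Otimes>\<^sub>M lborel. Q z" using assms unfolding lborel_prod .
  then obtain N where N: "{z \<in> space (lborel \<Otimes>\<^sub>M lborel). \<not> Q z} \<subseteq> N"
    "N \<in> null_sets (lborel \<Otimes>\<^sub>M lborel)"
    unfolding eventually_ae_filter by auto
  have "AE z in lborel \<Otimes>\<^sub>M lborel. z \<notin> N" by (rule AE_not_in[OF N(2)])
  then have "AE x in lborel. AE y in lborel. (x, y) \<notin> N" by (rule lborel_pair.AE_pair)
  moreover have "{z \<in> space (lborel \<Otimes>\<^sub>M lborel). (fst z, snd z) \<notin> N} \<in> sets (lborel \<Otimes>\<^sub>M lborel)"
    using sets.compl_sets[OF null_setsD2[OF N(2)]] by (simp add: set_diff_eq)
  ultimately have "AE y in lborel. AE x in lborel. (x, y) \<notin> N"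
    by (subst (asm) lborel_pair.AE_commute) auto
  then show ?thesis
  proof eventually_elim
    case (elim y)
    then show ?case by eventually_elim (use N(1) in \<open>auto simp: space_pair_measure\<close>)
  qed
qed

lemma strip_sets [simp]: "strip \<in> sets borel" "rectangle \<xi> \<in> sets borel"
  by (auto simp: strip_def rectangle_def intro!: borel_open open_Times)

text \<open>Lebesgue measurable functions in the plane need not be measurable for the product
  sigma-algebra; a Borel version makes Fubini applicable.\<close>

lemma borel_representative:
  fixes f :: "'a :: euclidean_space \<Rightarrow> real"
  assumes S: "S \<in> sets borel" and f: "f \<in> borel_measurable (lebesgue_on S)"
  obtains f' where "f' \<in> borel_measurable borel" "AE x in lborel. f' x = indicator S x * f x"
proof -
  have "(\<lambda>x. indicator S x * f x) \<in> borel_measurable lebesgue"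
    using f S by (subst (asm) borel_measurable_restrict_space_iff) auto
  from completion_ex_borel_measurable_real[OF this] that show thesis
    by (auto simp: eq_commute)
qed

text \<open>The strip norm is L^1 in \<open>y\<close> of the weighted L^p norm in \<open>x\<close>,
  and the latter dominates the L^1 norm of each slice. In the sequel the weight enters only through
  this lemma.\<close>

lemma Lp_strip_integrable:
  assumes p: "1 < p" and \<nu>: "\<nu> \<in> Muckenhoupt p" and g: "g \<in> Lp_strip p \<nu>"
  shows "integrable (lebesgue_on strip) g"
proof -
  from g have gm: "g \<in> borel_measurable (lebesgue_on strip)"
    and gn: "Lp_strip_norm p \<nu> g < \<infinity>" by (auto simp: Lp_strip_def)
  obtain g' where g' [measurable]: "g' \<in> borel_measurable borel"
    and eq: "AE z in lborel. g' z = indicator strip z * g z"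
    using borel_representative[OF _ gm] by auto
  have [measurable]: "g' \<in> borel_measurable (lborel \<Otimes>\<^sub>M lborel)"
    using g' by (simp add: lborel_prod)
  define C where "C = 1 + (\<integral>\<^sup>+ x. \<nu> x epowr (- 1 / (p - 1)) \<partial>lebesgue_on {0<..<2 * pi})"
  have "C < \<infinity>" using Muckenhoupt_dual_integrable[OF p \<nu>] by (simp add: C_def)
  have "1 \<le> C" by (simp add: C_def)
  obtain c where c: "C = ennreal c" "1 \<le> c"
    using \<open>C < \<infinity>\<close> \<open>1 \<le> C\<close> by (cases C) auto
  let ?h = "\<lambda>y. \<integral>\<^sup>+ x. ennreal \<bar>g' (x, y)\<bar> \<partial>lborel"
  \<comment> \<open>The constant stands on the left, next to the measurable \<open>?h\<close>: it
    can be pulled out of that integral without knowing that the weighted norm depends measurably on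
    \<open>y\<close>.\<close>
  have "AE y in lborel. ennreal (1 / c) * ?h y \<le> Lp_interval_norm p \<nu> (\<lambda>x. g (x, y)) * indicator {0<..} y"
    using AE_lborel_snd[OF eq]
  proof eventually_elim
    case (elim y)
    show ?case
    proof (cases "0 < y")
      case False
      then have "?h y = (\<integral>\<^sup>+ x. 0 \<partial>(lborel :: real measure))"
        using elim by (intro nn_integral_cong_AE) (auto simp: strip_def)
      then show ?thesis by simp
    next
      case True
      have ae: "AE x in lebesgue_on {0<..<2 * pi}. g' (x, y) = g (x, y)"
        by (subst AE_restrict_space_iff)
          (use AE_completion[OF elim] True in \<open>auto simp: strip_def\<close>)
      have "?h y = (\<integral>\<^sup>+ x. ennreal \<bar>g' (x, y)\<bar> * indicator {0<..<2 * pi} x \<partial>lborel)"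
        using elim by (intro nn_integral_cong_AE) (auto simp: strip_def indicator_def)
      also have "\<dots> = (\<integral>\<^sup>+ x. ennreal \<bar>g' (x, y)\<bar> \<partial>lebesgue_on {0<..<2 * pi})"
        by (simp add: nn_integral_restrict_space nn_integral_completion)
      also have "\<dots> \<le> C * Lp_interval_norm p \<nu> (\<lambda>x. g' (x, y))"
        unfolding C_def
        by (intro L1_le_Lp_interval_norm[OF p \<nu>] measurable_restrict_space1 measurable_completion) simp
      also have "Lp_interval_norm p \<nu> (\<lambda>x. g' (x, y)) = Lp_interval_norm p \<nu> (\<lambda>x. g (x, y))"
        unfolding Lp_interval_norm_def
        by (intro arg_cong2[of _ _ _ _ "(epowr)"] nn_integral_cong_AE) (use ae in auto)
      finally have "ennreal (1 / c) * ?h y \<le> ennreal (1 / c) * (C * Lp_interval_norm p \<nu> (\<lambda>x. g (x, y)))"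
        by (intro mult_left_mono) auto
      also have "\<dots> = Lp_interval_norm p \<nu> (\<lambda>x. g (x, y))"
        using c by (simp add: mult.assoc[symmetric] ennreal_mult[symmetric])
      finally show ?thesis using True by simp
    qed
  qed
  then have "(\<integral>\<^sup>+ y. ennreal (1 / c) * ?h y \<partial>lborel) \<le>
      (\<integral>\<^sup>+ y. Lp_interval_norm p \<nu> (\<lambda>x. g (x, y)) * indicator {0<..} y \<partial>lborel)"
    by (rule nn_integral_mono_AE)
  also have "\<dots> = Lp_strip_norm p \<nu> g"
    by (simp add: Lp_strip_norm_def nn_integral_restrict_space nn_integral_completion)
  finally have "ennreal (1 / c) * (\<integral>\<^sup>+ y. ?h y \<partial>lborel) < \<infinity>"
    using gn by (subst (asm) nn_integral_cmult) auto
  then have "(\<integral>\<^sup>+ y. ?h y \<partial>lborel) < \<infinity>"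
    using c by (auto simp: ennreal_mult_less_top)
  also have "(\<integral>\<^sup>+ y. ?h y \<partial>lborel) = (\<integral>\<^sup>+ z. ennreal \<bar>g' z\<bar> \<partial>(lborel \<Otimes>\<^sub>M lborel))"
    by (rule lborel_pair.nn_integral_snd) simp
  also have "\<dots> = (\<integral>\<^sup>+ z. ennreal \<bar>g z\<bar> * indicator strip z \<partial>lborel)"
    using eq by (simp add: lborel_prod, intro nn_integral_cong_AE) (auto simp: indicator_def)
  also have "\<dots> = (\<integral>\<^sup>+ z. ennreal (norm (g z)) \<partial>lebesgue_on strip)"
    by (simp add: nn_integral_restrict_space nn_integral_completion)
  finally show ?thesis using gm by (simp add: integrable_iff_bounded)
qed

section \<open>Integration by parts and weak gradients on rectangles\<close>

lemma integrable_lebesgue_on_subset: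
  fixes f :: "'a::euclidean_space \<Rightarrow> real"
  assumes f: "integrable (lebesgue_on T) f" and "S \<subseteq> T" "S \<in> sets lebesgue" "T \<in> sets lebesgue"
  shows "integrable (lebesgue_on S) f"
proof -
  have "integrable lebesgue (\<lambda>x. indicator T x *\<^sub>R f x)"
    using f assms(4) by (subst (asm) integrable_restrict_space) auto
  then have "integrable lebesgue (\<lambda>x. indicator S x *\<^sub>R (indicator T x *\<^sub>R f x))"
    by (rule integrable_mult_indicator[OF assms(3)])
  also have "(\<lambda>x. indicator S x *\<^sub>R (indicator T x *\<^sub>R f x)) = (\<lambda>x. indicator S x *\<^sub>R f x)"
    using assms(2) by (auto simp: indicator_def fun_eq_iff)
  finally have "integrable lebesgue (\<lambda>x. indicator S x *\<^sub>R f x)" .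
  then show ?thesis using assms(3) by (subst integrable_restrict_space) auto
qed

lemma integral_lebesgue_on_subset:
  fixes f :: "'a::euclidean_space \<Rightarrow> real"
  assumes "S \<subseteq> T" "S \<in> sets lebesgue" "T \<in> sets lebesgue" "\<And>x. x \<in> T - S \<Longrightarrow> f x = 0"
  shows "integral\<^sup>L (lebesgue_on T) f = integral\<^sup>L (lebesgue_on S) f"
  using assms by (auto simp: integral_restrict_space indicator_def intro!: Bochner_Integration.integral_cong)

lemma lebesgue_on_measurableI:
  "f \<in> borel_measurable borel \<Longrightarrow> f \<in> borel_measurable (lebesgue_on S)"
  by (intro measurable_restrict_space1 measurable_completion) simp

lemma smooth_measurable: "smooth a \<Longrightarrow> a \<in> borel_measurable borel"
  by (intro borel_measurable_continuous_onI smooth_continuous_on)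

lemma prod_measurable:
  assumes "smooth a" "smooth b"
  shows "(\<lambda>z. a (fst z) * b (snd z)) \<in> borel_measurable (lebesgue_on S)"
proof (rule lebesgue_on_measurableI)
  note [measurable] = assms[THEN smooth_measurable]
  show "(\<lambda>z. a (fst z) * b (snd z)) \<in> borel_measurable borel"
    by (simp add: borel_prod[symmetric])
qed

lemma smooth_bounded_Icc:
  assumes "smooth a" obtains C where "0 \<le> C" "\<And>x. x \<in> {l..r} \<Longrightarrow> \<bar>a x\<bar> \<le> C"
proof -
  have "bounded (a ` {l..r})"
    by (intro compact_imp_bounded compact_continuous_image smooth_continuous_on assms) auto
  then obtain C where "0 < C" "\<forall>x\<in>a ` {l..r}. norm x \<le> C" by (auto simp: bounded_pos)
  then show thesis by (intro that[of C]) auto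
qed

lemma prod_bounded_rectangle:
  assumes "smooth a" "smooth b"
  obtains C where "0 \<le> C" "\<And>z. z \<in> rectangle \<xi> \<Longrightarrow> \<bar>a (fst z) * b (snd z)\<bar> \<le> C"
proof -
  obtain A where A: "0 \<le> A" "\<And>x. x \<in> {0..2 * pi} \<Longrightarrow> \<bar>a x\<bar> \<le> A" using smooth_bounded_Icc[OF assms(1)] by blast
  obtain B where B: "0 \<le> B" "\<And>x. x \<in> {0..\<xi>} \<Longrightarrow> \<bar>b x\<bar> \<le> B" using smooth_bounded_Icc[OF assms(2)] by blast
  show thesis
  proof (rule that[of "A * B"])
    show "0 \<le> A * B" using A B by simp
    show "\<bar>a (fst z) * b (snd z)\<bar> \<le> A * B" if "z \<in> rectangle \<xi>" for z
      using that A B unfolding abs_mult by (intro mult_mono) (auto simp: rectangle_def)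
  qed
qed

lemma rectangle_eq_box: "rectangle \<xi> = box (0, 0) (2 * pi, \<xi>)"
  by (simp add: rectangle_def box_prod)

lemma closure_rectangle:
  assumes "0 < \<xi>" shows "closure (rectangle \<xi>) = cbox (0, 0) (2 * pi, \<xi>)"
proof -
  have "(pi, \<xi> / 2) \<in> rectangle \<xi>" using assms by (simp add: rectangle_def)
  then show ?thesis unfolding rectangle_eq_box by (intro closure_box) auto
qed

lemma Basis_real2: "(Basis :: (real \<times> real) set) = {(1, 0), (0, 1)}"
  by (auto simp: Basis_prod_def)

text \<open>The functions obtained are the witnesses behind \<open>smooth_upto\<close>. They are
  continuous up to the boundary, whereas \<Phi> is arbitrary outside the closure, so its
  \<open>gradient\<close> is controlled only in the open rectangle.\<close>

lemma smooth_upto_rectangleE: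
  assumes "smooth_upto (rectangle \<xi>) \<Phi>" "0 < \<xi>"
  obtains P P\<^sub>x P\<^sub>y where
    "\<And>z. z \<in> cbox (0, 0) (2 * pi, \<xi>) \<Longrightarrow> \<Phi> z = P z"
    "\<And>z. z \<in> rectangle \<xi> \<Longrightarrow> gradient \<Phi> z = (P\<^sub>x z, P\<^sub>y z)"
    "continuous_on (cbox (0, 0) (2 * pi, \<xi>)) P"
    "continuous_on (cbox (0, 0) (2 * pi, \<xi>)) P\<^sub>x"
    "continuous_on (cbox (0, 0) (2 * pi, \<xi>)) P\<^sub>y"
    "\<And>x y. (x, y) \<in> rectangle \<xi> \<Longrightarrow> ((\<lambda>x. P (x, y)) has_real_derivative P\<^sub>x (x, y)) (at x)"
    "\<And>x y. (x, y) \<in> rectangle \<xi> \<Longrightarrow> ((\<lambda>y. P (x, y)) has_real_derivative P\<^sub>y (x, y)) (at y)"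
proof -
  let ?K = "cbox (0, 0) (2 * pi, \<xi>) :: (real \<times> real) set"
  from assms obtain D where D: "\<forall>z\<in>?K. D [] z = \<Phi> z"
    "\<forall>bs. set bs \<subseteq> Basis \<longrightarrow> continuous_on ?K (D bs) \<and>
       (\<forall>z\<in>rectangle \<xi>. GDERIV (D bs) z :> (\<Sum>b\<in>Basis. D (b # bs) z *\<^sub>R b))"
    unfolding smooth_upto_def closure_rectangle[OF assms(2)] by blast
  have der: "(D [] has_derivative (\<lambda>h. h \<bullet> (D [(1, 0)] z, D [(0, 1)] z))) (at z)" if "z \<in> rectangle \<xi>" for z
    using D(2)[rule_format, of "[]"] that by (auto simp: gderiv_def Basis_real2)
  have cont: "continuous_on ?K (D bs)" if "set bs \<subseteq> Basis" for bs using D(2) that by blast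
  have sub: "rectangle \<xi> \<subseteq> ?K" unfolding rectangle_eq_box by (rule box_subset_cbox)
  have op: "open (rectangle \<xi>)" unfolding rectangle_eq_box by (rule open_box)
  show thesis
  proof
    show "\<Phi> z = D [] z" if "z \<in> ?K" for z using D(1) that by simp
    show "gradient \<Phi> z = (D [(1, 0)] z, D [(0, 1)] z)" if "z \<in> rectangle \<xi>" for z
    proof (rule gradient_eqI)
      show "(\<Phi> has_derivative (\<lambda>h. h \<bullet> (D [(1, 0)] z, D [(0, 1)] z))) (at z)"
        by (rule has_derivative_transform_within_open[OF der[OF that] op that]) (use D(1) sub in auto)
    qed
    show "continuous_on ?K (D [])" "continuous_on ?K (D [(1, 0)])" "continuous_on ?K (D [(0, 1)])"
      by (auto intro!: cont simp: Basis_real2)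
  next
    fix x y assume xy: "(x, y) \<in> rectangle \<xi>"
    have "((\<lambda>x. (x, y)) has_derivative (\<lambda>h. (h, 0))) (at x)"
      by (auto intro!: derivative_eq_intros)
    from has_derivative_compose[OF this der[OF xy]]
    show "((\<lambda>x. D [] (x, y)) has_real_derivative D [(1, 0)] (x, y)) (at x)"
      by (rule has_derivative_imp_has_field_derivative) simp
    have "((\<lambda>y. (x, y)) has_derivative (\<lambda>h. (0, h))) (at y)"
      by (auto intro!: derivative_eq_intros)
    from has_derivative_compose[OF this der[OF xy]]
    show "((\<lambda>y. D [] (x, y)) has_real_derivative D [(0, 1)] (x, y)) (at y)"
      by (rule has_derivative_imp_has_field_derivative) simp
  qed
qed

lemma integral_rectangle_continuous:
  fixes K :: "real \<times> real \<Rightarrow> real"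
  assumes "continuous_on (cbox (0, 0) (2 * pi, \<xi>)) K"
  shows "integrable (lebesgue_on (rectangle \<xi>)) K"
    and "integral\<^sup>L (lebesgue_on (rectangle \<xi>)) K
      = integral {0<..<2 * pi} (\<lambda>x. integral {0<..<\<xi>} (\<lambda>y. K (x, y)))"
    and "integral\<^sup>L (lebesgue_on (rectangle \<xi>)) K
      = integral {0<..<\<xi>} (\<lambda>y. integral {0<..<2 * pi} (\<lambda>x. K (x, y)))"
proof -
  show int: "integrable (lebesgue_on (rectangle \<xi>)) K"
    by (rule integrable_lebesgue_on_subset[OF continuous_imp_integrable[OF assms]])
      (auto simp: rectangle_eq_box box_subset_cbox)
  have *: "integral\<^sup>L (lebesgue_on (rectangle \<xi>)) K = integral (cbox (0, 0) (2 * pi, \<xi>)) K"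
    by (subst lebesgue_integral_eq_integral[OF int]) (simp_all add: rectangle_eq_box integral_open_interval)
  from integral_prod_continuous[OF assms] *
  show 1: "integral\<^sup>L (lebesgue_on (rectangle \<xi>)) K
      = integral {0<..<2 * pi} (\<lambda>x. integral {0<..<\<xi>} (\<lambda>y. K (x, y)))"
    by (simp add: integral_open_interval_real)
  have "continuous_on (cbox (0, 0) (2 * pi, \<xi>)) (\<lambda>(x, y). K (x, y))"
    using assms by simp
  from integral_swap_continuous[OF this] 1
  show "integral\<^sup>L (lebesgue_on (rectangle \<xi>)) K
      = integral {0<..<\<xi>} (\<lambda>y. integral {0<..<2 * pi} (\<lambda>x. K (x, y)))"
    by (simp add: integral_open_interval_real)
qed

lemma continuous_on_smooth_fst: "smooth a \<Longrightarrow> continuous_on S (\<lambda>z. a (fst z))"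
  and continuous_on_smooth_snd: "smooth a \<Longrightarrow> continuous_on S (\<lambda>z. a (snd z))"
  by (rule continuous_on_compose2[OF smooth_continuous_on[of _ UNIV]]; auto intro!: continuous_intros)+

lemma integrable_Ioo_continuous:
  fixes f :: "real \<Rightarrow> real"
  assumes "continuous_on {l..r} f" shows "integrable (lebesgue_on {l<..<r}) f"
  by (rule integrable_lebesgue_on_subset[OF continuous_imp_integrable_real[OF assms]]) auto

text \<open>Fubini and the fundamental theorem on each horizontal line, in the interior version:
  continuity holds up to the sides, differentiability only inside. The choice of \<open>a\<close>
  will decide which side survives.\<close>

lemma rectangle_ibp_x:
  assumes \<Phi>: "smooth_upto (rectangle \<xi>) \<Phi>" and \<xi>: "0 < \<xi>"
    and a: "smooth a" "\<And>x. (a has_real_derivative a' x) (at x)" and b: "smooth b"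
  shows "(LINT z|lebesgue_on (rectangle \<xi>). \<Phi> z * (a' (fst z) * b (snd z)) + (gradient \<Phi> z \<bullet> (1, 0)) * (a (fst z) * b (snd z)))
    = (LINT y|lebesgue_on {0<..<\<xi>}. \<Phi> (2 * pi, y) * (a (2 * pi) * b y) - \<Phi> (0, y) * (a 0 * b y))"
proof -
  let ?K = "cbox (0, 0) (2 * pi, \<xi>) :: (real \<times> real) set"
  obtain P P\<^sub>x P\<^sub>y where P: "\<And>z. z \<in> ?K \<Longrightarrow> \<Phi> z = P z"
    "\<And>z. z \<in> rectangle \<xi> \<Longrightarrow> gradient \<Phi> z = (P\<^sub>x z, P\<^sub>y z)"
    "continuous_on ?K P" "continuous_on ?K P\<^sub>x" "continuous_on ?K P\<^sub>y"
    "\<And>x y. (x, y) \<in> rectangle \<xi> \<Longrightarrow> ((\<lambda>x. P (x, y)) has_real_derivative P\<^sub>x (x, y)) (at x)"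
    "\<And>x y. (x, y) \<in> rectangle \<xi> \<Longrightarrow> ((\<lambda>y. P (x, y)) has_real_derivative P\<^sub>y (x, y)) (at y)"
    by (fact smooth_upto_rectangleE[OF \<Phi> \<xi>])
  have sub: "rectangle \<xi> \<subseteq> ?K" unfolding rectangle_eq_box by (rule box_subset_cbox)
  have a': "smooth a'" by (rule smooth_DERIV_cong[OF a])
  let ?H = "\<lambda>z. P z * (a' (fst z) * b (snd z)) + P\<^sub>x z * (a (fst z) * b (snd z))"
  have H: "continuous_on ?K ?H"
    by (intro continuous_intros P(3,4) continuous_on_smooth_fst continuous_on_smooth_snd a a' b)
  have "(LINT z|lebesgue_on (rectangle \<xi>). \<Phi> z * (a' (fst z) * b (snd z)) + (gradient \<Phi> z \<bullet> (1, 0)) * (a (fst z) * b (snd z)))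
     = integral\<^sup>L (lebesgue_on (rectangle \<xi>)) ?H"
    using sub by (intro Bochner_Integration.integral_cong) (auto simp: P(1,2))
  also have "\<dots> = integral {0<..<\<xi>} (\<lambda>y. integral {0<..<2 * pi} (\<lambda>x. ?H (x, y)))"
    by (rule integral_rectangle_continuous(3)[OF H])
  also have "\<dots> = integral {0<..<\<xi>} (\<lambda>y. \<Phi> (2 * pi, y) * (a (2 * pi) * b y) - \<Phi> (0, y) * (a 0 * b y))"
  proof (rule Henstock_Kurzweil_Integration.integral_cong)
    fix y assume y: "y \<in> {0<..<\<xi>}"
    have "((\<lambda>x. ?H (x, y)) has_integral P (2 * pi, y) * a (2 * pi) * b y - P (0, y) * a 0 * b y) {0..2 * pi}"
    proof (rule fundamental_theorem_of_calculus_interior)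
      show "continuous_on {0..2 * pi} (\<lambda>x. P (x, y) * a x * b y)"
        using y by (intro continuous_intros continuous_on_compose2[OF P(3)] smooth_continuous_on a) auto
      show "((\<lambda>x. P (x, y) * a x * b y) has_vector_derivative ?H (x, y)) (at x)"
        if "x \<in> {0<..<2 * pi}" for x
        using that y by (auto simp: has_real_derivative_iff_has_vector_derivative[symmetric] rectangle_def algebra_simps
          intro!: derivative_eq_intros P(6) a(2))
    qed simp
    then have "integral {0..2 * pi} (\<lambda>x. ?H (x, y)) = P (2 * pi, y) * a (2 * pi) * b y - P (0, y) * a 0 * b y"
      by (rule integral_unique)
    then show "integral {0<..<2 * pi} (\<lambda>x. ?H (x, y)) = \<Phi> (2 * pi, y) * (a (2 * pi) * b y) - \<Phi> (0, y) * (a 0 * b y)"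
      using y by (simp add: P(1) integral_open_interval_real)
  qed
  also have "\<dots> = (LINT y|lebesgue_on {0<..<\<xi>}. \<Phi> (2 * pi, y) * (a (2 * pi) * b y) - \<Phi> (0, y) * (a 0 * b y))"
  proof (rule lebesgue_integral_eq_integral[symmetric])
    have "continuous_on {0..\<xi>} (\<lambda>y. P (2 * pi, y) * (a (2 * pi) * b y) - P (0, y) * (a 0 * b y))"
      by (intro continuous_intros continuous_on_compose2[OF P(3)] smooth_continuous_on b) auto
    then have "integrable (lebesgue_on {0<..<\<xi>}) (\<lambda>y. P (2 * pi, y) * (a (2 * pi) * b y) - P (0, y) * (a 0 * b y))"
      by (rule integrable_Ioo_continuous)
    also have "?this \<longleftrightarrow> integrable (lebesgue_on {0<..<\<xi>}) (\<lambda>y. \<Phi> (2 * pi, y) * (a (2 * pi) * b y) - \<Phi> (0, y) * (a 0 * b y))"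
      by (rule Bochner_Integration.integrable_cong) (auto simp: P(1))
    finally show "integrable (lebesgue_on {0<..<\<xi>}) (\<lambda>y. \<Phi> (2 * pi, y) * (a (2 * pi) * b y) - \<Phi> (0, y) * (a 0 * b y))" .
  qed simp
  finally show ?thesis .
qed

lemma rectangle_ibp_y:
  assumes \<Phi>: "smooth_upto (rectangle \<xi>) \<Phi>" and \<xi>: "0 < \<xi>"
    and a: "smooth a" and b: "smooth b" "\<And>y. (b has_real_derivative b' y) (at y)"
  shows "(LINT z|lebesgue_on (rectangle \<xi>). \<Phi> z * (a (fst z) * b' (snd z)) + (gradient \<Phi> z \<bullet> (0, 1)) * (a (fst z) * b (snd z)))
    = (LINT x|lebesgue_on {0<..<2 * pi}. \<Phi> (x, \<xi>) * (b \<xi> * a x) - \<Phi> (x, 0) * (b 0 * a x))"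
proof -
  let ?K = "cbox (0, 0) (2 * pi, \<xi>) :: (real \<times> real) set"
  obtain P P\<^sub>x P\<^sub>y where P: "\<And>z. z \<in> ?K \<Longrightarrow> \<Phi> z = P z"
    "\<And>z. z \<in> rectangle \<xi> \<Longrightarrow> gradient \<Phi> z = (P\<^sub>x z, P\<^sub>y z)"
    "continuous_on ?K P" "continuous_on ?K P\<^sub>x" "continuous_on ?K P\<^sub>y"
    "\<And>x y. (x, y) \<in> rectangle \<xi> \<Longrightarrow> ((\<lambda>x. P (x, y)) has_real_derivative P\<^sub>x (x, y)) (at x)"
    "\<And>x y. (x, y) \<in> rectangle \<xi> \<Longrightarrow> ((\<lambda>y. P (x, y)) has_real_derivative P\<^sub>y (x, y)) (at y)"
    by (fact smooth_upto_rectangleE[OF \<Phi> \<xi>])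
  have sub: "rectangle \<xi> \<subseteq> ?K" unfolding rectangle_eq_box by (rule box_subset_cbox)
  have b': "smooth b'" by (rule smooth_DERIV_cong[OF b])
  let ?H = "\<lambda>z. P z * (a (fst z) * b' (snd z)) + P\<^sub>y z * (a (fst z) * b (snd z))"
  have H: "continuous_on ?K ?H"
    by (intro continuous_intros P(3,5) continuous_on_smooth_fst continuous_on_smooth_snd a b b')
  have "(LINT z|lebesgue_on (rectangle \<xi>). \<Phi> z * (a (fst z) * b' (snd z)) + (gradient \<Phi> z \<bullet> (0, 1)) * (a (fst z) * b (snd z)))
     = integral\<^sup>L (lebesgue_on (rectangle \<xi>)) ?H"
    using sub by (intro Bochner_Integration.integral_cong) (auto simp: P(1,2))
  also have "\<dots> = integral {0<..<2 * pi} (\<lambda>x. integral {0<..<\<xi>} (\<lambda>y. ?H (x, y)))"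
    by (rule integral_rectangle_continuous(2)[OF H])
  also have "\<dots> = integral {0<..<2 * pi} (\<lambda>x. \<Phi> (x, \<xi>) * (b \<xi> * a x) - \<Phi> (x, 0) * (b 0 * a x))"
  proof (rule Henstock_Kurzweil_Integration.integral_cong)
    fix x assume x: "x \<in> {0<..<2 * pi}"
    have "((\<lambda>y. ?H (x, y)) has_integral P (x, \<xi>) * b \<xi> * a x - P (x, 0) * b 0 * a x) {0..\<xi>}"
    proof (rule fundamental_theorem_of_calculus_interior)
      show "continuous_on {0..\<xi>} (\<lambda>y. P (x, y) * b y * a x)"
        using x by (intro continuous_intros continuous_on_compose2[OF P(3)] smooth_continuous_on b) auto
      show "((\<lambda>y. P (x, y) * b y * a x) has_vector_derivative ?H (x, y)) (at y)"
        if "y \<in> {0<..<\<xi>}" for y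
        using that x by (auto simp: has_real_derivative_iff_has_vector_derivative[symmetric] rectangle_def algebra_simps
          intro!: derivative_eq_intros P(7) b(2))
    qed (use \<xi> in simp)
    then have "integral {0..\<xi>} (\<lambda>y. ?H (x, y)) = P (x, \<xi>) * b \<xi> * a x - P (x, 0) * b 0 * a x"
      by (rule integral_unique)
    then show "integral {0<..<\<xi>} (\<lambda>y. ?H (x, y)) = \<Phi> (x, \<xi>) * (b \<xi> * a x) - \<Phi> (x, 0) * (b 0 * a x)"
      using x \<xi> by (simp add: P(1) integral_open_interval_real)
  qed
  also have "\<dots> = (LINT x|lebesgue_on {0<..<2 * pi}. \<Phi> (x, \<xi>) * (b \<xi> * a x) - \<Phi> (x, 0) * (b 0 * a x))"
  proof (rule lebesgue_integral_eq_integral[symmetric])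
    have "continuous_on {0..2 * pi} (\<lambda>x. P (x, \<xi>) * (b \<xi> * a x) - P (x, 0) * (b 0 * a x))"
      using \<xi> by (intro continuous_intros continuous_on_compose2[OF P(3)] smooth_continuous_on a) auto
    then have "integrable (lebesgue_on {0<..<2 * pi}) (\<lambda>x. P (x, \<xi>) * (b \<xi> * a x) - P (x, 0) * (b 0 * a x))"
      by (rule integrable_Ioo_continuous)
    also have "?this \<longleftrightarrow> integrable (lebesgue_on {0<..<2 * pi}) (\<lambda>x. \<Phi> (x, \<xi>) * (b \<xi> * a x) - \<Phi> (x, 0) * (b 0 * a x))"
      using \<xi> by (intro Bochner_Integration.integrable_cong) (auto simp: P(1))
    finally show "integrable (lebesgue_on {0<..<2 * pi}) (\<lambda>x. \<Phi> (x, \<xi>) * (b \<xi> * a x) - \<Phi> (x, 0) * (b 0 * a x))" .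
  qed simp
  finally show ?thesis .
qed

text \<open>The convergence in \<open>has_trace\<close> concerns nonnegative integrals and does not
  presuppose an integrable limit; finite distance to one integrable \<open>F n\<close> supplies it.
  The second claim is the limit passage against a bounded factor.\<close>

lemma L1_limit:
  fixes F :: "nat \<Rightarrow> 'a \<Rightarrow> real"
  assumes F: "\<And>n. integrable M (F n)" and f [measurable]: "f \<in> borel_measurable M"
    and lim: "(\<lambda>n. \<integral>\<^sup>+ x. ennreal \<bar>F n x - f x\<bar> \<partial>M) \<longlonglongrightarrow> 0"
  shows "integrable M f"
    and "\<lbrakk>\<psi> \<in> borel_measurable M; 0 \<le> C; \<And>x. x \<in> space M \<Longrightarrow> \<bar>\<psi> x\<bar> \<le> C\<rbrakk>
      \<Longrightarrow> (\<lambda>n. \<integral>x. F n x * \<psi> x \<partial>M) \<longlonglongrightarrow> (\<integral>x. f x * \<psi> x \<partial>M)"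
proof -
  have [measurable]: "F n \<in> borel_measurable M" for n using F by auto
  have "\<forall>\<^sub>F n in sequentially. (\<integral>\<^sup>+ x. ennreal \<bar>F n x - f x\<bar> \<partial>M) < 1"
    using lim by (rule order_tendstoD) simp
  then obtain n where "(\<integral>\<^sup>+ x. ennreal \<bar>F n x - f x\<bar> \<partial>M) < 1"
    by (auto simp: eventually_sequentially)
  then have "(\<integral>\<^sup>+ x. ennreal \<bar>F n x - f x\<bar> \<partial>M) < \<infinity>"
    by (rule order.strict_trans) simp
  then have "integrable M (\<lambda>x. F n x - f x)"
    by (intro integrableI_bounded) auto
  from Bochner_Integration.integrable_diff[OF F[of n] this] show int: "integrable M f" by simp
  assume \<psi> [measurable]: "\<psi> \<in> borel_measurable M" and C: "0 \<le> C" "\<And>x. x \<in> space M \<Longrightarrow> \<bar>\<psi> x\<bar> \<le> C"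
  show "(\<lambda>n. \<integral>x. F n x * \<psi> x \<partial>M) \<longlonglongrightarrow> (\<integral>x. f x * \<psi> x \<partial>M)"
  proof (rule tendsto_L1_int)
    show "integrable M (\<lambda>x. F n x * \<psi> x)" for n
      by (rule integrable_mult_bounded[OF F \<psi>]) (use C in auto)
    show "integrable M (\<lambda>x. f x * \<psi> x)"
      by (rule integrable_mult_bounded[OF int \<psi>]) (use C in auto)
    have bound: "(\<integral>\<^sup>+ x. ennreal (norm (F n x * \<psi> x - f x * \<psi> x)) \<partial>M)
        \<le> ennreal C * (\<integral>\<^sup>+ x. ennreal \<bar>F n x - f x\<bar> \<partial>M)" for n
    proof -
      have "(\<integral>\<^sup>+ x. ennreal (norm (F n x * \<psi> x - f x * \<psi> x)) \<partial>M)
          \<le> (\<integral>\<^sup>+ x. ennreal C * ennreal \<bar>F n x - f x\<bar> \<partial>M)"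
      proof (rule nn_integral_mono)
        fix x assume "x \<in> space M"
        then have "\<bar>\<psi> x\<bar> * \<bar>F n x - f x\<bar> \<le> C * \<bar>F n x - f x\<bar>"
          by (intro mult_right_mono C) auto
        moreover have "norm (F n x * \<psi> x - f x * \<psi> x) = \<bar>\<psi> x\<bar> * \<bar>F n x - f x\<bar>"
          by (simp add: abs_mult[symmetric] right_diff_distrib mult.commute)
        ultimately show "ennreal (norm (F n x * \<psi> x - f x * \<psi> x)) \<le> ennreal C * ennreal \<bar>F n x - f x\<bar>"
          using C(1) by (simp add: ennreal_mult[symmetric] ennreal_leI)
      qed
      also have "\<dots> = ennreal C * (\<integral>\<^sup>+ x. ennreal \<bar>F n x - f x\<bar> \<partial>M)"
        by (rule nn_integral_cmult) simp
      finally show ?thesis .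
    qed
    have "(\<lambda>n. ennreal C * (\<integral>\<^sup>+ x. ennreal \<bar>F n x - f x\<bar> \<partial>M)) \<longlonglongrightarrow> ennreal C * 0"
    proof (rule ennreal_tendsto_cmult)
      show "ennreal C < top" by simp
    qed (rule lim)
    then have lim0: "(\<lambda>n. ennreal C * (\<integral>\<^sup>+ x. ennreal \<bar>F n x - f x\<bar> \<partial>M)) \<longlonglongrightarrow> 0"
      by simp
    show "(\<lambda>n. \<integral>\<^sup>+ x. ennreal (norm (F n x * \<psi> x - f x * \<psi> x)) \<partial>M) \<longlonglongrightarrow> 0"
    proof (rule tendsto_sandwich[OF _ _ tendsto_const lim0])
      show "\<forall>\<^sub>F n in sequentially. (\<integral>\<^sup>+ x. ennreal (norm (F n x * \<psi> x - f x * \<psi> x)) \<partial>M)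
          \<le> ennreal C * (\<integral>\<^sup>+ x. ennreal \<bar>F n x - f x\<bar> \<partial>M)"
        by (intro always_eventually allI bound)
    qed simp
  qed
qed

section \<open>Cutoffs and the comparison of weak gradients\<close>

lemma gradient_outside_support:
  assumes "z \<notin> closure {z. \<phi> z \<noteq> 0}" shows "gradient \<phi> z = 0"
proof (rule gradient_eqI)
  have "((\<lambda>_. 0 :: real) has_derivative (\<lambda>h. h \<bullet> 0)) (at z)" by simp
  then show "(\<phi> has_derivative (\<lambda>h. h \<bullet> 0)) (at z)"
    by (rule has_derivative_transform_within_open[where s = "- closure {z. \<phi> z \<noteq> 0}"])
      (use assms closure_subset[of "{z. \<phi> z \<noteq> 0}"] in auto)
qed

text \<open>Two factors exp (-1/s), one per end, with s = (k+1) x - 1 and s = (k+1) (r - x) - 1. The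
  shift by 1 keeps the support at distance 1/(k+1) from the ends, and s tends to infinity in the
  interior. There is no plateau; values in [0, 1] with pointwise limit 1 suit dominated
  convergence.\<close>

definition cutoff :: "real \<Rightarrow> nat \<Rightarrow> real \<Rightarrow> real"
  where "cutoff r k x = bump [:1:] (real (Suc k) * x + - 1) * bump [:1:] (- real (Suc k) * x + (real (Suc k) * r - 1))"

lemma smooth_cutoff: "smooth (cutoff r k)"
  unfolding cutoff_def[abs_def] by (intro smooth_mult smooth_affine_comp smooth_bump)

lemma bump_one_bounds: "0 \<le> bump [:1:] x" "bump [:1:] x \<le> 1"
  by (auto simp: bump_def)

lemma cutoff_bounds: "0 \<le> cutoff r k x" "cutoff r k x \<le> 1"
  by (auto simp: cutoff_def bump_one_bounds intro!: mult_le_one)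

lemma cutoff_support: "x \<notin> {1 / real (Suc k)..r - 1 / real (Suc k)} \<Longrightarrow> cutoff r k x = 0"
  by (auto simp: cutoff_def field_simps simp del: of_nat_Suc)

lemma cutoff_tendsto:
  assumes "0 < x" "x < r" shows "(\<lambda>k. cutoff r k x) \<longlonglongrightarrow> 1"
proof -
  have *: "(\<lambda>k. bump [:1:] (real (Suc k) * t + - 1)) \<longlonglongrightarrow> 1" if "0 < t" for t
  proof -
    have "filterlim (\<lambda>k. - 1 + real (Suc k) * t) at_top sequentially"
      by (intro filterlim_tendsto_add_at_top[OF tendsto_const] filterlim_at_top_mult_tendsto_pos[OF tendsto_const that]
          filterlim_compose[OF filterlim_real_sequentially filterlim_Suc])
    from filterlim_compose[OF bump_tendsto[of "[:1:]"] this] show ?thesis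
      by (simp only: add.commute[of "- 1"]) simp
  qed
  have "(\<lambda>k. bump [:1:] (real (Suc k) * x + - 1) * bump [:1:] (real (Suc k) * (r - x) + - 1)) \<longlonglongrightarrow> 1 * 1"
    using assms by (intro tendsto_mult *) auto
  then show ?thesis by (simp add: cutoff_def algebra_simps)
qed

text \<open>A trace brings its own weak gradient on the rectangle. It is compared with
  \<open>G\<close> only against products, which cutoffs turn into test functions. The term pairing
  \<open>u\<close> with the gradient of the test function is common to both identities and cancels
  before the limit, so the steep derivatives of the cutoffs do no harm.\<close>

lemma weak_gradients_agree:
  assumes G: "weak_gradient strip u G" and G': "weak_gradient (rectangle \<xi>) u G'"
    and e: "e \<in> Basis"
    and intG: "integrable (lebesgue_on (rectangle \<xi>)) (\<lambda>z. G z \<bullet> e)"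
    and intG': "integrable (lebesgue_on (rectangle \<xi>)) (\<lambda>z. G' z \<bullet> e)"
    and a: "smooth a" and b: "smooth b"
  shows "(LINT z|lebesgue_on (rectangle \<xi>). (G z \<bullet> e) * (a (fst z) * b (snd z)))
    = (LINT z|lebesgue_on (rectangle \<xi>). (G' z \<bullet> e) * (a (fst z) * b (snd z)))"
proof -
  let ?R = "lebesgue_on (rectangle \<xi>)"
  define a\<^sub>c where "a\<^sub>c k x = cutoff (2 * pi) k x * a x" for k x
  define b\<^sub>c where "b\<^sub>c k y = cutoff \<xi> k y * b y" for k y
  define \<phi> where "\<phi> k = (\<lambda>z. a\<^sub>c k (fst z) * b\<^sub>c k (snd z))" for k
  have sm: "smooth (a\<^sub>c k)" "smooth (b\<^sub>c k)" for k
    unfolding a\<^sub>c_def[abs_def] b\<^sub>c_def[abs_def] by (intro smooth_mult smooth_cutoff a b)+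
  have subR: "rectangle \<xi> \<subseteq> strip" by (auto simp: rectangle_def strip_def)
  have test: "\<phi> k \<in> test_functions (rectangle \<xi>)" for k
    unfolding \<phi>_def
  proof (rule test_functions_prod[OF sm])
    let ?d = "1 / real (Suc k)"
    have d: "0 < ?d" by simp
    show "{?d..2 * pi - ?d} \<times> {?d..\<xi> - ?d} \<subseteq> rectangle \<xi>"
      unfolding rectangle_def
    proof (intro Sigma_mono subsetI)
      show "x \<in> {0<..<2 * pi}" if "x \<in> {?d..2 * pi - ?d}" for x
        using d that unfolding atLeastAtMost_iff greaterThanLessThan_iff by linarith
      show "y \<in> {0<..<\<xi>}" if "y \<in> {?d..\<xi> - ?d}" for y
        using d that unfolding atLeastAtMost_iff greaterThanLessThan_iff by linarith
    qed
  qed (simp_all add: a\<^sub>c_def b\<^sub>c_def cutoff_support)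
  then have test': "\<phi> k \<in> test_functions strip" for k
    using subR by (fastforce simp: test_functions_def)
  have out: "\<phi> k z = 0" "gradient (\<phi> k) z = 0" if "z \<notin> rectangle \<xi>" for z k
  proof -
    have z: "z \<notin> closure {z. \<phi> k z \<noteq> 0}" using test[of k] that by (auto simp: test_functions_def)
    then show "\<phi> k z = 0" using closure_subset[of "{z. \<phi> k z \<noteq> 0}"] by auto
    from z show "gradient (\<phi> k) z = 0" by (rule gradient_outside_support)
  qed
  have restrict: "integral\<^sup>L (lebesgue_on strip) f = integral\<^sup>L ?R f"
    if "\<And>z. z \<notin> rectangle \<xi> \<Longrightarrow> f z = 0" for f :: "real \<times> real \<Rightarrow> real"
    using that subR by (intro integral_lebesgue_on_subset) auto
  have eq: "(LINT z|?R. (G z \<bullet> e) * \<phi> k z) = (LINT z|?R. (G' z \<bullet> e) * \<phi> k z)" for k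
  proof -
    have "(LINT z|lebesgue_on strip. u z * (gradient (\<phi> k) z \<bullet> e)) = - (LINT z|lebesgue_on strip. (G z \<bullet> e) * \<phi> k z)"
      using G test'[of k] e by (auto simp: weak_gradient_def)
    moreover have "(LINT z|?R. u z * (gradient (\<phi> k) z \<bullet> e)) = - (LINT z|?R. (G' z \<bullet> e) * \<phi> k z)"
      using G' test[of k] e by (auto simp: weak_gradient_def)
    ultimately show ?thesis
      by (simp add: restrict out)
  qed
  obtain C where C: "0 \<le> C" "\<And>z. z \<in> rectangle \<xi> \<Longrightarrow> \<bar>a (fst z) * b (snd z)\<bar> \<le> C"
    using prod_bounded_rectangle[OF a b] by blast
  have lim: "(\<lambda>k. LINT z|?R. g z * \<phi> k z) \<longlonglongrightarrow> (LINT z|?R. g z * (a (fst z) * b (snd z)))"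
    if g: "integrable ?R g" for g :: "real \<times> real \<Rightarrow> real"
  proof (rule integral_dominated_convergence[where w = "\<lambda>z. C * \<bar>g z\<bar>"])
    note [measurable] = borel_measurable_integrable[OF g] prod_measurable[OF a b] prod_measurable[OF sm]
    show "(\<lambda>z. g z * (a (fst z) * b (snd z))) \<in> borel_measurable ?R" by measurable
    show "(\<lambda>z. g z * \<phi> k z) \<in> borel_measurable ?R" for k unfolding \<phi>_def by measurable
    show "integrable ?R (\<lambda>z. C * \<bar>g z\<bar>)" using g by simp
    show "AE z in ?R. (\<lambda>k. g z * \<phi> k z) \<longlonglongrightarrow> g z * (a (fst z) * b (snd z))"
    proof (rule AE_I2)
      fix z assume "z \<in> space ?R"
      then have "(\<lambda>k. g z * \<phi> k z) \<longlonglongrightarrow> g z * ((1 * a (fst z)) * (1 * b (snd z)))"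
        unfolding \<phi>_def a\<^sub>c_def b\<^sub>c_def
        by (intro tendsto_intros cutoff_tendsto) (auto simp: rectangle_def)
      then show "(\<lambda>k. g z * \<phi> k z) \<longlonglongrightarrow> g z * (a (fst z) * b (snd z))" by simp
    qed
    show "AE z in ?R. norm (g z * \<phi> k z) \<le> C * \<bar>g z\<bar>" for k
    proof (rule AE_I2)
      fix z assume "z \<in> space ?R"
      then have "\<bar>a (fst z) * b (snd z)\<bar> \<le> C" using C by simp
      moreover have "\<bar>\<phi> k z\<bar> \<le> 1 * \<bar>a (fst z) * b (snd z)\<bar>"
      proof -
        have "\<bar>\<phi> k z\<bar> = (cutoff (2 * pi) k (fst z) * cutoff \<xi> k (snd z)) * \<bar>a (fst z) * b (snd z)\<bar>"
          by (simp add: \<phi>_def a\<^sub>c_def b\<^sub>c_def abs_mult cutoff_bounds)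
        also have "\<dots> \<le> 1 * \<bar>a (fst z) * b (snd z)\<bar>"
          by (intro mult_right_mono mult_le_one cutoff_bounds) auto
        finally show ?thesis .
      qed
      ultimately have "\<bar>\<phi> k z\<bar> \<le> C" by simp
      then show "norm (g z * \<phi> k z) \<le> C * \<bar>g z\<bar>"
        by (simp add: abs_mult mult.commute[of C] mult_left_mono)
    qed
  qed
  from lim[OF intG] lim[OF intG'] show ?thesis
    unfolding eq by (rule LIMSEQ_unique)
qed

section \<open>The weak problem tested against products\<close>

lemma smooth_upto_integrable:
  assumes "smooth_upto (rectangle \<xi>) \<Phi>" "0 < \<xi>"
  shows "integrable (lebesgue_on (rectangle \<xi>)) \<Phi>"
    and "e \<in> Basis \<Longrightarrow> integrable (lebesgue_on (rectangle \<xi>)) (\<lambda>z. gradient \<Phi> z \<bullet> e)"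
    and "0 \<le> x \<Longrightarrow> x \<le> 2 * pi \<Longrightarrow> integrable (lebesgue_on {0<..<\<xi>}) (\<lambda>y. \<Phi> (x, y))"
    and "integrable (lebesgue_on {0<..<2 * pi}) (\<lambda>x. \<Phi> (x, 0))"
proof -
  let ?K = "cbox (0, 0) (2 * pi, \<xi>) :: (real \<times> real) set"
  obtain P P\<^sub>x P\<^sub>y where P: "\<And>z. z \<in> ?K \<Longrightarrow> \<Phi> z = P z"
    "\<And>z. z \<in> rectangle \<xi> \<Longrightarrow> gradient \<Phi> z = (P\<^sub>x z, P\<^sub>y z)"
    "continuous_on ?K P" "continuous_on ?K P\<^sub>x" "continuous_on ?K P\<^sub>y"
    "\<And>x y. (x, y) \<in> rectangle \<xi> \<Longrightarrow> ((\<lambda>x. P (x, y)) has_real_derivative P\<^sub>x (x, y)) (at x)"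
    "\<And>x y. (x, y) \<in> rectangle \<xi> \<Longrightarrow> ((\<lambda>y. P (x, y)) has_real_derivative P\<^sub>y (x, y)) (at y)"
    by (fact smooth_upto_rectangleE[OF assms])
  have sub: "rectangle \<xi> \<subseteq> ?K" unfolding rectangle_eq_box by (rule box_subset_cbox)
  show "integrable (lebesgue_on (rectangle \<xi>)) \<Phi>"
    using integral_rectangle_continuous(1)[OF P(3)] sub
    by (subst Bochner_Integration.integrable_cong[OF refl, of _ _ P]) (auto simp: P(1))
  show "integrable (lebesgue_on (rectangle \<xi>)) (\<lambda>z. gradient \<Phi> z \<bullet> e)" if "e \<in> Basis"
  proof -
    from that consider "e = (1, 0)" | "e = (0, 1)" by (auto simp: Basis_real2)
    then show ?thesis
    proof cases
      case 1
      then show ?thesis using integral_rectangle_continuous(1)[OF P(4)]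
        by (subst Bochner_Integration.integrable_cong[OF refl, of _ _ P\<^sub>x]) (auto simp: P(2))
    next
      case 2
      then show ?thesis using integral_rectangle_continuous(1)[OF P(5)]
        by (subst Bochner_Integration.integrable_cong[OF refl, of _ _ P\<^sub>y]) (auto simp: P(2))
    qed
  qed
  show "integrable (lebesgue_on {0<..<\<xi>}) (\<lambda>y. \<Phi> (x, y))" if "0 \<le> x" "x \<le> 2 * pi"
  proof -
    have "integrable (lebesgue_on {0<..<\<xi>}) (\<lambda>y. P (x, y))"
      by (intro integrable_Ioo_continuous continuous_on_compose2[OF P(3)] continuous_intros) (use that in auto)
    then show ?thesis
      by (subst Bochner_Integration.integrable_cong[OF refl, of _ _ "\<lambda>y. P (x, y)"]) (use that in \<open>auto simp: P(1)\<close>)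
  qed
  have "integrable (lebesgue_on {0<..<2 * pi}) (\<lambda>x. P (x, 0))"
    by (intro integrable_Ioo_continuous continuous_on_compose2[OF P(3)] continuous_intros) (use assms(2) in auto)
  then show "integrable (lebesgue_on {0<..<2 * pi}) (\<lambda>x. \<Phi> (x, 0))"
    by (subst Bochner_Integration.integrable_cong[OF refl, of _ _ "\<lambda>x. P (x, 0)"]) (use assms(2) in \<open>auto simp: P(1)\<close>)
qed

text \<open>The limit passage shared by the left, right and bottom traces. In its uses
  \<open>ibp\<close> is integration by parts for smooth functions, \<open>c\<close> times
  \<open>d\<close> is the derivative of \<open>a\<close> times \<open>b\<close> in direction
  \<open>e\<close>, and \<beta> is the boundary weight. At the end the gradient supplied by the
  trace is exchanged for \<open>G\<close>.\<close>

lemma trace_identity: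
  assumes tr: "has_trace (rectangle \<xi>) \<gamma> {l<..<r} u g" and \<xi>: "0 < \<xi>"
    and G: "weak_gradient strip u G" and e: "e \<in> Basis"
    and intG: "integrable (lebesgue_on (rectangle \<xi>)) (\<lambda>z. G z \<bullet> e)"
    and sm: "smooth a" "smooth b" "smooth c" "smooth d" "smooth \<beta>"
    and intT: "\<And>\<Phi>. smooth_upto (rectangle \<xi>) \<Phi> \<Longrightarrow> integrable (lebesgue_on {l<..<r}) (\<lambda>t. \<Phi> (\<gamma> t))"
    and ibp: "\<And>\<Phi>. smooth_upto (rectangle \<xi>) \<Phi> \<Longrightarrow>
      (LINT z|lebesgue_on (rectangle \<xi>). \<Phi> z * (c (fst z) * d (snd z)) + (gradient \<Phi> z \<bullet> e) * (a (fst z) * b (snd z)))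
      = (LINT t|lebesgue_on {l<..<r}. \<Phi> (\<gamma> t) * \<beta> t)"
  shows "(LINT z|lebesgue_on (rectangle \<xi>). u z * (c (fst z) * d (snd z)))
       + (LINT z|lebesgue_on (rectangle \<xi>). (G z \<bullet> e) * (a (fst z) * b (snd z)))
      = (LINT t|lebesgue_on {l<..<r}. g t * \<beta> t)"
proof -
  let ?R = "lebesgue_on (rectangle \<xi>)" and ?T = "lebesgue_on {l<..<r}"
  from tr obtain G' \<Phi> where gm: "g \<in> borel_measurable ?T" and um: "u \<in> borel_measurable ?R"
    and Gm: "G' \<in> borel_measurable ?R" and G': "weak_gradient (rectangle \<xi>) u G'"
    and \<Phi>: "\<And>n::nat. smooth_upto (rectangle \<xi>) (\<Phi> n)"
    and lim1: "(\<lambda>n. \<integral>\<^sup>+ z. ennreal \<bar>\<Phi> n z - u z\<bar> \<partial>?R) \<longlonglongrightarrow> 0"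
    and lim2: "(\<lambda>n. \<integral>\<^sup>+ z. ennreal (norm (gradient (\<Phi> n) z - G' z)) \<partial>?R) \<longlonglongrightarrow> 0"
    and lim3: "(\<lambda>n. \<integral>\<^sup>+ t. ennreal \<bar>\<Phi> n (\<gamma> t) - g t\<bar> \<partial>?T) \<longlonglongrightarrow> 0"
    unfolding has_trace_def by blast
  note int1 = smooth_upto_integrable(1)[OF \<Phi> \<xi>]
  note int2 = smooth_upto_integrable(2)[OF \<Phi> \<xi> e]
  have Gem: "(\<lambda>z. G' z \<bullet> e) \<in> borel_measurable ?R" using Gm by measurable
  have lim2': "(\<lambda>n. \<integral>\<^sup>+ z. ennreal \<bar>gradient (\<Phi> n) z \<bullet> e - G' z \<bullet> e\<bar> \<partial>?R) \<longlonglongrightarrow> 0"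
  proof (rule tendsto_sandwich[OF _ _ tendsto_const lim2])
    have "\<bar>gradient (\<Phi> n) z \<bullet> e - G' z \<bullet> e\<bar> \<le> norm (gradient (\<Phi> n) z - G' z)" for n z
      using Basis_le_norm[OF e, of "gradient (\<Phi> n) z - G' z"] by (simp add: inner_diff_left)
    then show "\<forall>\<^sub>F n in sequentially. (\<integral>\<^sup>+ z. ennreal \<bar>gradient (\<Phi> n) z \<bullet> e - G' z \<bullet> e\<bar> \<partial>?R)
        \<le> (\<integral>\<^sup>+ z. ennreal (norm (gradient (\<Phi> n) z - G' z)) \<partial>?R)"
      by (intro always_eventually allI nn_integral_mono ennreal_leI)
  qed simp
  obtain A where A: "0 \<le> A" "\<And>z. z \<in> rectangle \<xi> \<Longrightarrow> \<bar>a (fst z) * b (snd z)\<bar> \<le> A"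
    using prod_bounded_rectangle[OF sm(1,2)] by blast
  obtain C where C: "0 \<le> C" "\<And>z. z \<in> rectangle \<xi> \<Longrightarrow> \<bar>c (fst z) * d (snd z)\<bar> \<le> C"
    using prod_bounded_rectangle[OF sm(3,4)] by blast
  obtain B where B: "0 \<le> B" "\<And>t. t \<in> {l..r} \<Longrightarrow> \<bar>\<beta> t\<bar> \<le> B"
    using smooth_bounded_Icc[OF sm(5)] by blast
  note m = prod_measurable[OF sm(1,2)] prod_measurable[OF sm(3,4)] lebesgue_on_measurableI[OF smooth_measurable[OF sm(5)]]
  have 1: "(\<lambda>n. LINT z|?R. \<Phi> n z * (c (fst z) * d (snd z))) \<longlonglongrightarrow> (LINT z|?R. u z * (c (fst z) * d (snd z)))"
    by (rule L1_limit(2)[OF int1 um lim1 m(2) C(1)]) (use C in auto)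
  have 2: "(\<lambda>n. LINT z|?R. (gradient (\<Phi> n) z \<bullet> e) * (a (fst z) * b (snd z))) \<longlonglongrightarrow> (LINT z|?R. (G' z \<bullet> e) * (a (fst z) * b (snd z)))"
    by (rule L1_limit(2)[OF int2 Gem lim2' m(1) A(1)]) (use A in auto)
  have 3: "(\<lambda>n. LINT t|?T. \<Phi> n (\<gamma> t) * \<beta> t) \<longlonglongrightarrow> (LINT t|?T. g t * \<beta> t)"
    by (rule L1_limit(2)[OF intT[OF \<Phi>] gm lim3 m(3) B(1)]) (use B in auto)
  have "(LINT z|?R. \<Phi> n z * (c (fst z) * d (snd z))) + (LINT z|?R. (gradient (\<Phi> n) z \<bullet> e) * (a (fst z) * b (snd z)))
      = (LINT t|?T. \<Phi> n (\<gamma> t) * \<beta> t)" for n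
    unfolding ibp[OF \<Phi>, symmetric]
    by (intro Bochner_Integration.integral_add[symmetric] integrable_mult_bounded[where C = C, OF int1 m(2)] integrable_mult_bounded[where C = A, OF int2 m(1)])
      (use A C in auto)
  with tendsto_add[OF 1 2] 3
  have "(LINT z|?R. u z * (c (fst z) * d (snd z))) + (LINT z|?R. (G' z \<bullet> e) * (a (fst z) * b (snd z)))
      = (LINT t|?T. g t * \<beta> t)"
    by (simp add: LIMSEQ_unique)
  moreover have "integrable ?R (\<lambda>z. G' z \<bullet> e)"
    by (rule L1_limit(1)[OF int2 Gem lim2'])
  ultimately show ?thesis
    using weak_gradients_agree[OF G G' e intG _ sm(1,2)] by simp
qed

lemma strip_test_functions_prod:
  assumes "smooth a" "smooth b" "a (2 * pi) = 0" "b 0 = 0" "0 < \<xi>" "\<And>y. \<xi> \<le> y \<Longrightarrow> b y = 0"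
  shows "(\<lambda>z. a (fst z) * b (snd z)) \<in> strip_test_functions"
  using assms by (auto simp: strip_test_functions_def intro!: smooth_upto_prod)

text \<open>Green's identity: the weak equation is tested with \<open>a\<close> times
  \<open>b\<close>, and the remaining derivative is moved from \<open>u\<close> to the test
  function. The lateral terms carry \<open>a' 0\<close> and \<open>a' (2 * pi)\<close> and cancel by
  equality of the traces, the top term vanishes, and the bottom one carries \<open>f\<close>. The
  right-hand side depends on the data alone, so it is the same for every solution.\<close>

lemma weak_solution_identity:
  assumes p: "1 < p" and \<nu>: "\<nu> \<in> Muckenhoupt p"
    and f: "f \<in> borel_measurable (lebesgue_on {0<..<2 * pi})"
    and sol: "weak_solution p \<nu> f h u"
    and a: "smooth a" "\<And>x. (a has_real_derivative a' x) (at x)" "\<And>x. (a' has_real_derivative a'' x) (at x)"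
    and b: "smooth b" "\<And>y. (b has_real_derivative b' y) (at y)" "\<And>y. (b' has_real_derivative b'' y) (at y)"
    and a_bd: "a (2 * pi) = 0" "a' 0 = a' (2 * pi)"
    and b_bd: "b 0 = 0" "0 < \<xi>" "\<And>y. \<xi> \<le> y \<Longrightarrow> b y = 0 \<and> b' y = 0 \<and> b'' y = 0"
  shows "(LINT z|lebesgue_on strip. u z * (a'' (fst z) * b (snd z) + a (fst z) * b'' (snd z)))
    = (LINT y|lebesgue_on {0<..}. a 0 * b y * h y) - (LINT x|lebesgue_on {0<..<2 * pi}. f x * (b' 0 * a x))"
proof -
  let ?R = "lebesgue_on (rectangle \<xi>)"
  from sol obtain G g\<^sub>0 g\<^sub>1 g where u: "u \<in> Lp_strip p \<nu>" and G: "weak_gradient strip u G"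
    and GLp: "\<And>e. e \<in> Basis \<Longrightarrow> (\<lambda>z. G z \<bullet> e) \<in> Lp_strip p \<nu>"
    and weak: "\<And>\<phi>. \<phi> \<in> strip_test_functions \<Longrightarrow>
          (LINT z|lebesgue_on strip. G z \<bullet> gradient \<phi> z) + (LINT y|lebesgue_on {0<..}. \<phi> (0, y) * h y) = 0"
    and g0: "vertical_trace 0 u g\<^sub>0" and g1: "vertical_trace (2 * pi) u g\<^sub>1"
    and g01: "AE y in lebesgue_on {0<..}. g\<^sub>0 y = g\<^sub>1 y"
    and g: "bottom_trace u g" "AE x in lebesgue_on {0<..<2 * pi}. g x = f x"
    unfolding weak_solution_def W1p_strip_def by blast
  have subR: "rectangle \<xi> \<subseteq> strip" by (auto simp: rectangle_def strip_def)
  have sm: "smooth a'" "smooth a''" "smooth b'" "smooth b''"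
    using smooth_DERIV_cong a b by blast+
  have restrict: "integrable ?R q" if "integrable (lebesgue_on strip) q" for q :: "real \<times> real \<Rightarrow> real"
    by (rule integrable_lebesgue_on_subset[OF that subR]) auto
  have uR: "integrable ?R u" by (intro restrict Lp_strip_integrable[OF p \<nu> u])
  have GR: "integrable ?R (\<lambda>z. G z \<bullet> e)" if "e \<in> Basis" for e
    by (intro restrict Lp_strip_integrable[OF p \<nu> GLp[OF that]])
  have intprod: "integrable ?R (\<lambda>z. q z * (c (fst z) * d (snd z)))"
    if q: "integrable ?R q" and cd: "smooth c" "smooth d" for q c d
  proof -
    obtain C where C: "0 \<le> C" "\<And>z. z \<in> rectangle \<xi> \<Longrightarrow> \<bar>c (fst z) * d (snd z)\<bar> \<le> C"
      using prod_bounded_rectangle[OF cd] by blast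
    show ?thesis by (rule integrable_mult_bounded[OF q prod_measurable[OF cd], of C]) (use C in auto)
  qed
  have e: "(1, 0) \<in> (Basis :: (real \<times> real) set)" "(0, 1) \<in> (Basis :: (real \<times> real) set)"
    by (auto simp: Basis_real2)
  \<comment> \<open>The traces on the two sides come from separate approximating sequences, so each
    integration by parts may see only one side. Hence \<open>a'\<close> is split by the partition of
    unity 1 - x/(2 pi), x/(2 pi): \<alpha> vanishes at 2 pi and \<kappa> at 0, and at the other end
    each has the common value \<open>a' 0\<close>.\<close>
  define \<alpha> where "\<alpha> x = (1 + (- 1 / (2 * pi)) * x) * a' x" for x
  define \<alpha>' where "\<alpha>' x = (1 + (- 1 / (2 * pi)) * x) * a'' x + (- 1 / (2 * pi)) * a' x" for x
  define \<kappa> where "\<kappa> x = (1 / (2 * pi)) * x * a' x" for x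
  define \<kappa>' where "\<kappa>' x = (1 / (2 * pi)) * x * a'' x + (1 / (2 * pi)) * a' x" for x
  note smooths = smooth_add smooth_mult smooth_const smooth_ident sm a(1) b(1)
  have s\<alpha>: "smooth \<alpha>" "smooth \<alpha>'" "smooth \<kappa>" "smooth \<kappa>'"
    unfolding \<alpha>_def[abs_def] \<alpha>'_def[abs_def] \<kappa>_def[abs_def] \<kappa>'_def[abs_def]
    by (intro smooths)+
  have d\<alpha>: "(\<alpha> has_real_derivative \<alpha>' x) (at x)" for x
    unfolding \<alpha>_def[abs_def] \<alpha>'_def by (auto intro!: derivative_eq_intros a(3) simp: field_simps)
  have d\<kappa>: "(\<kappa> has_real_derivative \<kappa>' x) (at x)" for x
    unfolding \<kappa>_def[abs_def] \<kappa>'_def by (auto intro!: derivative_eq_intros a(3) simp: field_simps)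
  have ends: "\<alpha> 0 = a' 0" "\<alpha> (2 * pi) = 0" "\<kappa> 0 = 0" "\<kappa> (2 * pi) = a' 0"
    by (simp_all add: \<alpha>_def \<kappa>_def a_bd)
  have left: "(LINT z|?R. u z * (\<alpha>' (fst z) * b (snd z))) + (LINT z|?R. (G z \<bullet> (1, 0)) * (\<alpha> (fst z) * b (snd z)))
      = (LINT y|lebesgue_on {0<..<\<xi>}. g\<^sub>0 y * (- a' 0 * b y))"
  proof (rule trace_identity[OF _ b_bd(2) G e(1) GR[OF e(1)] s\<alpha>(1) b(1) s\<alpha>(2) b(1)])
    show "has_trace (rectangle \<xi>) (\<lambda>y. (0, y)) {0<..<\<xi>} u g\<^sub>0" using g0 b_bd(2) by (auto simp: vertical_trace_def)
    show "smooth (\<lambda>y. - a' 0 * b y)" by (intro smooths)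
    show "integrable (lebesgue_on {0<..<\<xi>}) (\<lambda>y. \<Phi> (0, y))" if "smooth_upto (rectangle \<xi>) \<Phi>" for \<Phi>
      by (rule smooth_upto_integrable(3)[OF that b_bd(2)]) auto
  qed (subst rectangle_ibp_x[OF _ b_bd(2) s\<alpha>(1) d\<alpha> b(1)], auto simp: ends)
  have right: "(LINT z|?R. u z * (\<kappa>' (fst z) * b (snd z))) + (LINT z|?R. (G z \<bullet> (1, 0)) * (\<kappa> (fst z) * b (snd z)))
      = (LINT y|lebesgue_on {0<..<\<xi>}. g\<^sub>1 y * (a' 0 * b y))"
  proof (rule trace_identity[OF _ b_bd(2) G e(1) GR[OF e(1)] s\<alpha>(3) b(1) s\<alpha>(4) b(1)])
    show "has_trace (rectangle \<xi>) (\<lambda>y. (2 * pi, y)) {0<..<\<xi>} u g\<^sub>1" using g1 b_bd(2) by (auto simp: vertical_trace_def)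
    show "smooth (\<lambda>y. a' 0 * b y)" by (intro smooths)
    show "integrable (lebesgue_on {0<..<\<xi>}) (\<lambda>y. \<Phi> (2 * pi, y))" if "smooth_upto (rectangle \<xi>) \<Phi>" for \<Phi>
      by (rule smooth_upto_integrable(3)[OF that b_bd(2)]) auto
  qed (subst rectangle_ibp_x[OF _ b_bd(2) s\<alpha>(3) d\<kappa> b(1)], auto simp: ends)
  \<comment> \<open>Here \<open>b'\<close> takes the place of \<open>b\<close>; since it vanishes at
    \<xi>, only the bottom side contributes.\<close>
  have bottom: "(LINT z|?R. u z * (a (fst z) * b'' (snd z))) + (LINT z|?R. (G z \<bullet> (0, 1)) * (a (fst z) * b' (snd z)))
      = (LINT x|lebesgue_on {0<..<2 * pi}. g x * (- b' 0 * a x))"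
  proof (rule trace_identity[OF _ b_bd(2) G e(2) GR[OF e(2)] a(1) sm(3) a(1) sm(4)])
    show "has_trace (rectangle \<xi>) (\<lambda>x. (x, 0)) {0<..<2 * pi} u g" using g b_bd(2) by (auto simp: bottom_trace_def)
    show "smooth (\<lambda>x. - b' 0 * a x)" by (intro smooths)
    show "integrable (lebesgue_on {0<..<2 * pi}) (\<lambda>x. \<Phi> (x, 0))" if "smooth_upto (rectangle \<xi>) \<Phi>" for \<Phi>
      by (rule smooth_upto_integrable(4)[OF that b_bd(2)])
  qed (subst rectangle_ibp_y[OF _ b_bd(2) a(1) sm(3) b(3)], use b_bd in auto)
  have "g\<^sub>0 \<in> borel_measurable (lebesgue_on {0<..<\<xi>})" "g\<^sub>1 \<in> borel_measurable (lebesgue_on {0<..<\<xi>})"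
    using g0 g1 b_bd(2) by (auto simp: vertical_trace_def has_trace_def)
  moreover have ae01: "AE y in lebesgue_on {0<..<\<xi>}. g\<^sub>0 y = g\<^sub>1 y"
  proof -
    have "AE y in lebesgue. y \<in> {0<..} \<longrightarrow> g\<^sub>0 y = g\<^sub>1 y" using g01 by (subst (asm) AE_restrict_space_iff) auto
    then have "AE y in lebesgue. y \<in> {0<..<\<xi>} \<longrightarrow> g\<^sub>0 y = g\<^sub>1 y" by eventually_elim auto
    then show ?thesis by (subst AE_restrict_space_iff) auto
  qed
  moreover have bm: "(\<lambda>y. a' 0 * b y) \<in> borel_measurable (lebesgue_on {0<..<\<xi>})"
    by (intro lebesgue_on_measurableI smooth_measurable smooths)
  ultimately have "(LINT y|lebesgue_on {0<..<\<xi>}. g\<^sub>1 y * (a' 0 * b y)) = (LINT y|lebesgue_on {0<..<\<xi>}. g\<^sub>0 y * (a' 0 * b y))"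
    by (intro integral_cong_AE) (auto intro: eventually_mono[OF ae01])
  then have sides: "(LINT y|lebesgue_on {0<..<\<xi>}. g\<^sub>0 y * (- a' 0 * b y)) + (LINT y|lebesgue_on {0<..<\<xi>}. g\<^sub>1 y * (a' 0 * b y)) = 0"
    by simp
  have x: "(LINT z|?R. u z * (a'' (fst z) * b (snd z))) + (LINT z|?R. (G z \<bullet> (1, 0)) * (a' (fst z) * b (snd z))) = 0"
  proof -
    have "\<alpha>' t + \<kappa>' t = a'' t" "\<alpha> t + \<kappa> t = a' t" for t
      by (simp_all add: \<alpha>_def \<kappa>_def \<alpha>'_def \<kappa>'_def field_simps)
    then have eq: "q * (a'' t * s) = q * (\<alpha>' t * s) + q * (\<kappa>' t * s)" "q * (a' t * s) = q * (\<alpha> t * s) + q * (\<kappa> t * s)" for q t s :: real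
      by (metis distrib_left distrib_right)+
    have "(LINT z|?R. u z * (a'' (fst z) * b (snd z))) =
        (LINT z|?R. u z * (\<alpha>' (fst z) * b (snd z))) + (LINT z|?R. u z * (\<kappa>' (fst z) * b (snd z)))"
      unfolding eq by (intro Bochner_Integration.integral_add intprod uR s\<alpha> b(1))
    moreover have "(LINT z|?R. (G z \<bullet> (1, 0)) * (a' (fst z) * b (snd z))) =
        (LINT z|?R. (G z \<bullet> (1, 0)) * (\<alpha> (fst z) * b (snd z))) + (LINT z|?R. (G z \<bullet> (1, 0)) * (\<kappa> (fst z) * b (snd z)))"
      unfolding eq by (intro Bochner_Integration.integral_add intprod GR e s\<alpha> b(1))
    ultimately show ?thesis using left right sides by linarith
  qed
  let ?\<phi> = "\<lambda>z. a (fst z) * b (snd z)"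
  have grad: "gradient ?\<phi> z = (a' (fst z) * b (snd z), a (fst z) * b' (snd z))" for z
    by (rule gradient_prod[OF a(2) b(2)])
  have outside: "b (snd z) = 0" "b' (snd z) = 0" "b'' (snd z) = 0" if "z \<in> strip - rectangle \<xi>" for z
  proof -
    have "\<xi> \<le> snd z" using that by (auto simp: strip_def rectangle_def not_less[symmetric])
    then show "b (snd z) = 0" "b' (snd z) = 0" "b'' (snd z) = 0" using b_bd(3) by blast+
  qed
  have strip_R: "integral\<^sup>L (lebesgue_on strip) q = integral\<^sup>L ?R q"
    if "\<And>z. z \<in> strip - rectangle \<xi> \<Longrightarrow> q z = 0" for q :: "real \<times> real \<Rightarrow> real"
    by (rule integral_lebesgue_on_subset[OF subR _ _ that]) auto
  have "(LINT z|lebesgue_on strip. G z \<bullet> gradient ?\<phi> z) = (LINT z|?R. G z \<bullet> gradient ?\<phi> z)"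
    by (rule strip_R) (simp add: grad outside zero_prod_def[symmetric])
  also have "\<dots> = (LINT z|?R. (G z \<bullet> (1, 0)) * (a' (fst z) * b (snd z)) + (G z \<bullet> (0, 1)) * (a (fst z) * b' (snd z)))"
    by (simp add: grad inner_prod_def)
  also have "\<dots> = (LINT z|?R. (G z \<bullet> (1, 0)) * (a' (fst z) * b (snd z))) + (LINT z|?R. (G z \<bullet> (0, 1)) * (a (fst z) * b' (snd z)))"
    by (intro Bochner_Integration.integral_add intprod GR e sm a(1) b(1))
  finally have grad_int: "(LINT z|lebesgue_on strip. G z \<bullet> gradient ?\<phi> z) = \<dots>" .
  have "(LINT z|lebesgue_on strip. u z * (a'' (fst z) * b (snd z) + a (fst z) * b'' (snd z)))
      = (LINT z|?R. u z * (a'' (fst z) * b (snd z)) + u z * (a (fst z) * b'' (snd z)))"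
    by (subst strip_R) (simp_all add: outside distrib_left)
  also have "\<dots> = (LINT z|?R. u z * (a'' (fst z) * b (snd z))) + (LINT z|?R. u z * (a (fst z) * b'' (snd z)))"
    by (intro Bochner_Integration.integral_add intprod uR sm a(1) b(1))
  also have "\<dots> = (LINT x|lebesgue_on {0<..<2 * pi}. g x * (- b' 0 * a x)) - (LINT z|lebesgue_on strip. G z \<bullet> gradient ?\<phi> z)"
    using x bottom grad_int by linarith
  also have "(LINT z|lebesgue_on strip. G z \<bullet> gradient ?\<phi> z) = - (LINT y|lebesgue_on {0<..}. a 0 * b y * h y)"
    using weak[OF strip_test_functions_prod[OF a(1) b(1) a_bd(1) b_bd(1,2)]] b_bd(3) by simp
  also have "(LINT x|lebesgue_on {0<..<2 * pi}. g x * (- b' 0 * a x)) = - (LINT x|lebesgue_on {0<..<2 * pi}. f x * (b' 0 * a x))"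
  proof -
    have "g \<in> borel_measurable (lebesgue_on {0<..<2 * pi})"
      using g(1) b_bd(2) by (auto simp: bottom_trace_def has_trace_def)
    moreover have "(\<lambda>x. b' 0 * a x) \<in> borel_measurable (lebesgue_on {0<..<2 * pi})"
      by (intro lebesgue_on_measurableI smooth_measurable smooths)
    ultimately have "(LINT x|lebesgue_on {0<..<2 * pi}. g x * (b' 0 * a x)) = (LINT x|lebesgue_on {0<..<2 * pi}. f x * (b' 0 * a x))"
      using f by (intro integral_cong_AE) (auto intro: eventually_mono[OF g(2)])
    then show ?thesis by simp
  qed
  finally show ?thesis by simp
qed

section \<open>Uniqueness for the homogeneous problem\<close>

lemma prod_borel_measurable:
  assumes "a \<in> borel_measurable borel" "b \<in> borel_measurable borel"
  shows "(\<lambda>z :: real \<times> real. a (fst z) * (b (snd z) :: real)) \<in> borel_measurable borel"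
proof -
  note [measurable] = assms
  show ?thesis by (simp add: borel_prod[symmetric])
qed

text \<open>Collects what the spectral argument uses of a difference of two solutions; weight, data
  and traces have disappeared. Extension by zero turns integrals over the strip into integrals over
  the plane.\<close>

locale homogeneous_solution =
  fixes U :: "real \<times> real \<Rightarrow> real"
  assumes integrable_U: "integrable lborel U"
    and U_supp: "\<And>z. z \<notin> strip \<Longrightarrow> U z = 0"
    and annihilates: "\<And>a a' a'' b b' b'' \<xi>.
      \<lbrakk>smooth a; \<And>x. (a has_real_derivative a' x) (at x); \<And>x. (a' has_real_derivative a'' x) (at x);
       smooth b; \<And>y. (b has_real_derivative b' y) (at y); \<And>y. (b' has_real_derivative b'' y) (at y);
       a (2 * pi) = 0; a' 0 = a' (2 * pi); b 0 = 0; 0 < \<xi>;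
       \<And>y. \<xi> \<le> y \<Longrightarrow> b y = 0 \<and> b' y = 0 \<and> b'' y = 0\<rbrakk>
      \<Longrightarrow> (\<integral>z. U z * (a'' (fst z) * b (snd z) + a (fst z) * b'' (snd z)) \<partial>lborel) = 0"
begin

text \<open>\<open>b\<close> is bounded only for y > 0, since exponentials decaying on the strip
  grow on the other side.\<close>

lemma integrable_prod:
  assumes a: "smooth a" and b: "b \<in> borel_measurable borel" "\<And>y. 0 < y \<Longrightarrow> \<bar>b y\<bar> \<le> B"
  shows "integrable lborel (\<lambda>z. U z * (a (fst z) * b (snd z)))"
proof -
  obtain A where A: "0 \<le> A" "\<And>x. x \<in> {0..2 * pi} \<Longrightarrow> \<bar>a x\<bar> \<le> A"
    using smooth_bounded_Icc[OF a] by blast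
  show ?thesis
  proof (rule integrable_mult_bounded[OF integrable_U, where C = "A * B"])
    show "(\<lambda>z. a (fst z) * b (snd z)) \<in> borel_measurable lborel"
      using prod_borel_measurable[OF smooth_measurable[OF a] b(1)] by simp
    fix z assume "U z \<noteq> 0"
    then have "z \<in> strip" using U_supp by blast
    then show "\<bar>a (fst z) * b (snd z)\<bar> \<le> A * B"
      unfolding abs_mult using A b(2) by (intro mult_mono) (auto simp: strip_def)
  qed
qed

lemma integral_iterated:
  assumes "integrable lborel (\<lambda>z. U z * (a (fst z) * b (snd z)))"
  shows "(\<integral>z. U z * (a (fst z) * b (snd z)) \<partial>lborel) = (\<integral>y. (\<integral>x. U (x, y) * a x \<partial>lborel) * b y \<partial>lborel)"
    and "integrable lborel (\<lambda>y. (\<integral>x. U (x, y) * a x \<partial>lborel) * b y)"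
proof -
  have eq: "(\<lambda>(x, y). U (x, y) * a x * b y) = (\<lambda>z. U z * (a (fst z) * b (snd z)))"
    by (auto simp: fun_eq_iff)
  have int: "integrable (lborel \<Otimes>\<^sub>M lborel) (\<lambda>(x, y). U (x, y) * a x * b y)"
    using assms unfolding eq lborel_prod .
  from lborel_pair.integral_snd[OF int]
  show "(\<integral>z. U z * (a (fst z) * b (snd z)) \<partial>lborel) = (\<integral>y. (\<integral>x. U (x, y) * a x \<partial>lborel) * b y \<partial>lborel)"
    unfolding eq lborel_prod by simp
  from lborel_pair.integrable_snd[OF int]
  show "integrable lborel (\<lambda>y. (\<integral>x. U (x, y) * a x \<partial>lborel) * b y)"
    by simp
qed

text \<open>\<open>Y\<close> is multiplied by a cutoff whose transition moves to infinity. The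
  cutoff tends to 1, its derivatives tend to 0, all uniformly bounded, and integrability of
  \<open>U\<close> gives the dominating function.\<close>

lemma annihilates_bounded:
  assumes v: "smooth v" "\<And>x. (v has_real_derivative v' x) (at x)" "\<And>x. (v' has_real_derivative v'' x) (at x)"
    and v_bd: "v (2 * pi) = 0" "v' 0 = v' (2 * pi)"
    and Y: "smooth Y" "\<And>y. (Y has_real_derivative Y' y) (at y)" "\<And>y. (Y' has_real_derivative Y'' y) (at y)"
    and Y0: "Y 0 = 0"
    and Y_bd: "\<And>y. 0 < y \<Longrightarrow> \<bar>Y y\<bar> \<le> B" "\<And>y. 0 < y \<Longrightarrow> \<bar>Y' y\<bar> \<le> B" "\<And>y. 0 < y \<Longrightarrow> \<bar>Y'' y\<bar> \<le> B"
  shows "(\<integral>z. U z * (v'' (fst z) * Y (snd z) + v (fst z) * Y'' (snd z)) \<partial>lborel) = 0"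
proof -
  \<comment> \<open>The polynomials of the first two derivatives of \<open>bump [:1:]\<close>. Both
    are divisible by t^2, so their constant coefficients, the limits at infinity, are 0.\<close>
  define P\<^sub>1 :: "real poly" where "P\<^sub>1 = [:0, 0, 1:] * ([:1:] - pderiv [:1:])"
  define P\<^sub>2 where "P\<^sub>2 = [:0, 0, 1:] * (P\<^sub>1 - pderiv P\<^sub>1)"
  define \<rho> where "\<rho> n y = bump [:1:] (real n - y)" for n y
  define \<rho>' where "\<rho>' n y = bump P\<^sub>1 (real n - y)" for n y
  define \<rho>'' where "\<rho>'' n y = bump P\<^sub>2 (real n - y)" for n y
  have at_top: "filterlim (\<lambda>n. real n - y) at_top sequentially" for y
    using filterlim_tendsto_add_at_top[OF tendsto_const filterlim_real_sequentially, of "- y"] by simp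
  have lim: "(\<lambda>n. \<rho> n y) \<longlonglongrightarrow> 1" "(\<lambda>n. \<rho>' n y) \<longlonglongrightarrow> 0" "(\<lambda>n. \<rho>'' n y) \<longlonglongrightarrow> 0" for y
    unfolding \<rho>_def \<rho>'_def \<rho>''_def
    using filterlim_compose[OF bump_tendsto[of "[:1:]"] at_top] filterlim_compose[OF bump_tendsto[of P\<^sub>1] at_top]
      filterlim_compose[OF bump_tendsto[of P\<^sub>2] at_top]
    by (simp_all add: P\<^sub>1_def P\<^sub>2_def coeff_mult_0)
  have d\<rho>: "(\<rho> n has_real_derivative - \<rho>' n y) (at y)" for n y
  proof -
    have "((\<lambda>y. bump [:1:] (real n - y)) has_real_derivative bump P\<^sub>1 (real n - y) * (- 1)) (at y)"
      unfolding P\<^sub>1_def by (rule DERIV_chain2[OF bump_has_derivative]) (auto intro!: derivative_eq_intros)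
    then show ?thesis by (simp add: \<rho>_def[abs_def] \<rho>'_def)
  qed
  have d\<rho>': "(\<rho>' n has_real_derivative - \<rho>'' n y) (at y)" for n y
  proof -
    have "((\<lambda>y. bump P\<^sub>1 (real n - y)) has_real_derivative bump P\<^sub>2 (real n - y) * (- 1)) (at y)"
      unfolding P\<^sub>2_def by (rule DERIV_chain2[OF bump_has_derivative]) (auto intro!: derivative_eq_intros)
    then show ?thesis by (simp add: \<rho>'_def[abs_def] \<rho>''_def)
  qed
  have s\<rho>: "smooth (\<rho> n)" for n
    using smooth_affine_comp[OF smooth_bump, of "[:1:]" "- 1" "real n"] by (simp add: \<rho>_def[abs_def])
  obtain M\<^sub>0 M\<^sub>1 M\<^sub>2 where M: "\<And>x. \<bar>bump [:1:] x\<bar> \<le> M\<^sub>0" "\<And>x. \<bar>bump P\<^sub>1 x\<bar> \<le> M\<^sub>1" "\<And>x. \<bar>bump P\<^sub>2 x\<bar> \<le> M\<^sub>2"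
    using bump_bounded by metis
  have M0: "0 \<le> M\<^sub>0" "0 \<le> M\<^sub>1" "0 \<le> M\<^sub>2" using M[of 0] by simp_all
  have "0 \<le> B" using Y_bd(1)[of 1] by simp
  define b where "b n y = Y y * \<rho> n y" for n y
  define b' where "b' n y = Y' y * \<rho> n y - Y y * \<rho>' n y" for n y
  define b'' where "b'' n y = Y'' y * \<rho> n y - 2 * (Y' y * \<rho>' n y) + Y y * \<rho>'' n y" for n y
  have db: "(b n has_real_derivative b' n y) (at y)" for n y
    unfolding b_def[abs_def] b'_def by (auto intro!: derivative_eq_intros Y d\<rho>)
  have db': "(b' n has_real_derivative b'' n y) (at y)" for n y
    unfolding b'_def[abs_def] b''_def by (auto intro!: derivative_eq_intros Y d\<rho> d\<rho>')
  have sb: "smooth (b n)" for n unfolding b_def[abs_def] by (intro smooth_mult Y s\<rho>)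
  have sv: "smooth v''" using smooth_DERIV_cong v by blast
  have sY: "smooth Y''" using smooth_DERIV_cong Y by blast
  have sb'': "smooth (b'' n)" for n using smooth_DERIV_cong sb db db' by blast
  \<comment> \<open>The cutoff already vanishes from y = n on; n + 1 is taken for \<xi> because
    \<xi> must be positive also for n = 0.\<close>
  have zero: "(\<integral>z. U z * (v'' (fst z) * b n (snd z) + v (fst z) * b'' n (snd z)) \<partial>lborel) = 0" for n
  proof (rule annihilates[OF v sb db db' v_bd, where \<xi> = "real (Suc n)"])
    show "b n 0 = 0" by (simp add: b_def Y0)
    show "b n y = 0 \<and> b' n y = 0 \<and> b'' n y = 0" if "real (Suc n) \<le> y" for y
      using that by (simp add: b_def b'_def b''_def \<rho>_def \<rho>'_def \<rho>''_def)
  qed simp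
  obtain A where A: "0 \<le> A" "\<And>x. x \<in> {0..2 * pi} \<Longrightarrow> \<bar>v x\<bar> \<le> A"
    using smooth_bounded_Icc[OF v(1)] by blast
  obtain A'' where A'': "0 \<le> A''" "\<And>x. x \<in> {0..2 * pi} \<Longrightarrow> \<bar>v'' x\<bar> \<le> A''"
    using smooth_bounded_Icc[OF sv] by blast
  define K where "K = A'' * (B * M\<^sub>0) + A * (B * M\<^sub>0 + 2 * (B * M\<^sub>1) + B * M\<^sub>2)"
  have bound: "\<bar>v'' (fst z) * b n (snd z) + v (fst z) * b'' n (snd z)\<bar> \<le> K" if "z \<in> strip" for z n
  proof -
    from that have z: "fst z \<in> {0..2 * pi}" "0 < snd z" by (auto simp: strip_def)
    note Y_bd = Y_bd[OF z(2)]
    have 0: "\<bar>b n (snd z)\<bar> \<le> B * M\<^sub>0"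
      unfolding b_def \<rho>_def abs_mult by (intro mult_mono Y_bd M \<open>0 \<le> B\<close>) auto
    have 1: "\<bar>Y'' (snd z) * \<rho> n (snd z)\<bar> \<le> B * M\<^sub>0" "\<bar>Y' (snd z) * \<rho>' n (snd z)\<bar> \<le> B * M\<^sub>1"
        "\<bar>Y (snd z) * \<rho>'' n (snd z)\<bar> \<le> B * M\<^sub>2"
      unfolding \<rho>_def \<rho>'_def \<rho>''_def abs_mult by (intro mult_mono Y_bd M \<open>0 \<le> B\<close>; simp)+
    then have "\<bar>b'' n (snd z)\<bar> \<le> B * M\<^sub>0 + 2 * (B * M\<^sub>1) + B * M\<^sub>2"
      unfolding b''_def by linarith
    then have "\<bar>v (fst z) * b'' n (snd z)\<bar> \<le> A * (B * M\<^sub>0 + 2 * (B * M\<^sub>1) + B * M\<^sub>2)"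
      unfolding abs_mult using A z by (intro mult_mono) auto
    moreover have "\<bar>v'' (fst z) * b n (snd z)\<bar> \<le> A'' * (B * M\<^sub>0)"
      unfolding abs_mult using A'' z 0 by (intro mult_mono) auto
    ultimately show ?thesis unfolding K_def by linarith
  qed
  have meas: "(\<lambda>z. U z * (v'' (fst z) * c (snd z) + v (fst z) * d (snd z))) \<in> borel_measurable lborel"
    if "smooth c" "smooth d" for c d
  proof (rule borel_measurable_times[OF borel_measurable_integrable[OF integrable_U]])
    show "(\<lambda>z. v'' (fst z) * c (snd z) + v (fst z) * d (snd z)) \<in> borel_measurable lborel"
      using prod_borel_measurable[OF smooth_measurable[OF sv] smooth_measurable[OF that(1)]]
        prod_borel_measurable[OF smooth_measurable[OF v(1)] smooth_measurable[OF that(2)]]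
      by (intro borel_measurable_add) simp_all
  qed
  have "(\<lambda>n. \<integral>z. U z * (v'' (fst z) * b n (snd z) + v (fst z) * b'' n (snd z)) \<partial>lborel)
      \<longlonglongrightarrow> (\<integral>z. U z * (v'' (fst z) * Y (snd z) + v (fst z) * Y'' (snd z)) \<partial>lborel)"
  proof (rule integral_dominated_convergence[where w = "\<lambda>z. K * \<bar>U z\<bar>"])
    show "integrable lborel (\<lambda>z. K * \<bar>U z\<bar>)" using integrable_U by simp
    show "AE z in lborel. (\<lambda>n. U z * (v'' (fst z) * b n (snd z) + v (fst z) * b'' n (snd z)))
        \<longlonglongrightarrow> U z * (v'' (fst z) * Y (snd z) + v (fst z) * Y'' (snd z))"
    proof (rule AE_I2)
      fix z :: "real \<times> real"
      have "(\<lambda>n. b n (snd z)) \<longlonglongrightarrow> Y (snd z) * 1"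
        unfolding b_def by (intro tendsto_intros lim)
      moreover have "(\<lambda>n. b'' n (snd z)) \<longlonglongrightarrow> Y'' (snd z) * 1 - 2 * (Y' (snd z) * 0) + Y (snd z) * 0"
        unfolding b''_def by (intro tendsto_intros lim)
      ultimately show "(\<lambda>n. U z * (v'' (fst z) * b n (snd z) + v (fst z) * b'' n (snd z)))
        \<longlonglongrightarrow> U z * (v'' (fst z) * Y (snd z) + v (fst z) * Y'' (snd z))"
        by (intro tendsto_intros) simp_all
    qed
    show "AE z in lborel. norm (U z * (v'' (fst z) * b n (snd z) + v (fst z) * b'' n (snd z))) \<le> K * \<bar>U z\<bar>" for n
    proof (rule AE_I2)
      fix z :: "real \<times> real"
      show "norm (U z * (v'' (fst z) * b n (snd z) + v (fst z) * b'' n (snd z))) \<le> K * \<bar>U z\<bar>"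
        using bound[of z n] U_supp[of z] unfolding real_norm_def abs_mult mult.commute[of K]
        by (cases "z \<in> strip") (auto intro!: mult_left_mono)
    qed
  qed (intro meas sb sb'' Y sY)+
  then show ?thesis by (simp add: zero LIMSEQ_const_iff)
qed

text \<open>With \<open>Y y = exp (- m y) - exp (- k y)\<close> the left-hand side of the identity is a multiple of
  the Laplace transform at \<open>k\<close> of the coefficient function of \<open>v\<close>.\<close>

lemma coefficient_vanishes:
  assumes v: "smooth v" "\<And>x. (v has_real_derivative v' x) (at x)"
      "\<And>x. (v' has_real_derivative r x - (real m)\<^sup>2 * v x) (at x)"
    and v_bd: "v (2 * pi) = 0" "v' 0 = v' (2 * pi)"
    and r: "smooth r" "AE y in lborel. (\<integral>x. U (x, y) * r x \<partial>lborel) = 0"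
  shows "AE y in lborel. (\<integral>x. U (x, y) * v x \<partial>lborel) = 0"
proof -
  let ?w = "\<lambda>y. \<integral>x. U (x, y) * v x \<partial>lborel"
  define E where "E k y = exp (- real k * y)" for k :: nat and y
  have sE: "smooth (E k)" for k unfolding E_def[abs_def] by (rule smooth_exp)
  have E_bd: "\<bar>E k y\<bar> \<le> 1" if "0 < y" for k y using that by (simp add: E_def)
  have mE: "E k \<in> borel_measurable borel" for k by (rule smooth_measurable[OF sE])
  have dE: "(E k has_real_derivative - real k * E k y) (at y)" for k y
    unfolding E_def[abs_def] by (auto intro!: derivative_eq_intros)
  \<comment> \<open>v'' Y + v Y'' collapses to r Y - (k^2 - m^2) v exp (-k y): the terms with v exp
    (-m y) cancel. The factor k^2 - m^2 is nonzero for k > m.\<close>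
  have laplace: "(\<integral>z. U z * (v (fst z) * E k (snd z)) \<partial>lborel) = 0" if "m < k" for k
  proof -
    let ?Y = "\<lambda>y. E m y - E k y"
    \<comment> \<open>One bound for \<open>?Y\<close> and its first two derivatives, which are
      bounded by 2, 2 k and 2 k^2.\<close>
    let ?B = "2 + 2 * real k + 2 * (real k)\<^sup>2"
    have mk: "real m \<le> real k" "(real m)\<^sup>2 \<le> (real k)\<^sup>2" using that by (auto intro!: power_mono)
    have Ym: "?Y \<in> borel_measurable borel" using mE by (intro borel_measurable_diff)
    have rY: "integrable lborel (\<lambda>z. U z * (r (fst z) * ?Y (snd z)))"
    proof (rule integrable_prod[OF r(1) Ym])
      show "\<bar>?Y y\<bar> \<le> 2" if "0 < y" for y using E_bd[OF that, of m] E_bd[OF that, of k] by linarith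
    qed
    have vE: "integrable lborel (\<lambda>z. U z * (v (fst z) * E k (snd z)))"
      by (rule integrable_prod[OF v(1) mE E_bd])
    have "(\<integral>z. U z * (r (fst z) * ?Y (snd z)) \<partial>lborel) = (\<integral>y. (\<integral>x. U (x, y) * r x \<partial>lborel) * ?Y y \<partial>lborel)"
      by (rule integral_iterated(1)[OF rY])
    also have "\<dots> = 0"
      by (rule integral_eq_zero_AE) (use r(2) in \<open>eventually_elim, simp\<close>)
    finally have rY0: "(\<integral>z. U z * (r (fst z) * ?Y (snd z)) \<partial>lborel) = 0" .
    have bd: "\<bar>real m ^ i * E m y\<bar> \<le> real k ^ i" "\<bar>real k ^ i * E k y\<bar> \<le> real k ^ i" if "0 < y" for y i
    proof -
      have "real m ^ i * \<bar>E m y\<bar> \<le> real k ^ i * 1" "real k ^ i * \<bar>E k y\<bar> \<le> real k ^ i * 1"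
        using mk(1) by (intro mult_mono power_mono E_bd that; simp)+
      then show "\<bar>real m ^ i * E m y\<bar> \<le> real k ^ i" "\<bar>real k ^ i * E k y\<bar> \<le> real k ^ i"
        by (simp_all add: abs_mult)
    qed
    have "(\<integral>z. U z * ((r (fst z) - (real m)\<^sup>2 * v (fst z)) * ?Y (snd z) +
        v (fst z) * ((real m)\<^sup>2 * E m (snd z) - (real k)\<^sup>2 * E k (snd z))) \<partial>lborel) = 0"
    proof (rule annihilates_bounded[OF v v_bd, where Y = ?Y and Y' = "\<lambda>y. real k * E k y - real m * E m y"
          and Y'' = "\<lambda>y. (real m)\<^sup>2 * E m y - (real k)\<^sup>2 * E k y" and B = ?B])
      show "smooth ?Y" by (intro smooth_diff sE)
      show "(?Y has_real_derivative real k * E k y - real m * E m y) (at y)" for y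
        by (auto intro!: derivative_eq_intros dE)
      show "((\<lambda>y. real k * E k y - real m * E m y) has_real_derivative (real m)\<^sup>2 * E m y - (real k)\<^sup>2 * E k y) (at y)" for y
        by (auto intro!: derivative_eq_intros dE simp: power2_eq_square)
      show "?Y 0 = 0" by (simp add: E_def)
      fix y :: real assume "0 < y"
      have "0 \<le> real k" "0 \<le> (real k)\<^sup>2" by auto
      then show "\<bar>?Y y\<bar> \<le> ?B" "\<bar>real k * E k y - real m * E m y\<bar> \<le> ?B" "\<bar>(real m)\<^sup>2 * E m y - (real k)\<^sup>2 * E k y\<bar> \<le> ?B"
        using bd[OF \<open>0 < y\<close>, of 0] bd[OF \<open>0 < y\<close>, of 1] bd[OF \<open>0 < y\<close>, of 2] unfolding power_0 power_one_right mult_1 by linarith+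
    qed
    also have "(\<lambda>z. U z * ((r (fst z) - (real m)\<^sup>2 * v (fst z)) * ?Y (snd z) +
        v (fst z) * ((real m)\<^sup>2 * E m (snd z) - (real k)\<^sup>2 * E k (snd z)))) =
       (\<lambda>z. U z * (r (fst z) * ?Y (snd z)) - ((real k)\<^sup>2 - (real m)\<^sup>2) * (U z * (v (fst z) * E k (snd z))))"
      by (auto simp: fun_eq_iff algebra_simps)
    finally have "((real k)\<^sup>2 - (real m)\<^sup>2) * (\<integral>z. U z * (v (fst z) * E k (snd z)) \<partial>lborel) = 0"
      using rY vE rY0 by (simp add: Bochner_Integration.integral_diff)
    with that show ?thesis by simp
  qed
  have vE: "integrable lborel (\<lambda>z. U z * (v (fst z) * E (Suc m) (snd z)))"
    by (rule integrable_prod[OF v(1) mE E_bd])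
  \<comment> \<open>The transform at m + 1 + j is the j-th moment in the variable exp (-y) of
    \<open>?w\<close> times exp (-(m+1) y). The extra exponential moves the first usable value k = m
    + 1 to j = 0.\<close>
  have "AE y in lborel. ?w y * E (Suc m) y = 0"
  proof (rule AE_zero_if_moments_zero[OF integral_iterated(2)[OF vE], where I = "{0<..}" and c = "E 1"])
    show "E 1 \<in> borel_measurable borel" by (rule mE)
    show "?w y * E (Suc m) y = 0" if "y \<notin> {0<..}" for y
      using U_supp[of "(_, y)"] that by (simp add: strip_def)
    show "\<bar>E 1 y\<bar> \<le> 1" if "y \<in> {0<..}" for y using that E_bd by simp
    show "(\<integral>y. ?w y * E (Suc m) y * E 1 y ^ j \<partial>lborel) = 0" for j
    proof -
      have "E (Suc m) y * E 1 y ^ j = E (Suc m + j) y" for y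
        by (simp add: E_def exp_of_nat_mult[symmetric] exp_add[symmetric] algebra_simps)
      then have "(\<integral>y. ?w y * E (Suc m) y * E 1 y ^ j \<partial>lborel) = (\<integral>y. ?w y * E (Suc m + j) y \<partial>lborel)"
        by (simp add: mult.assoc)
      also have "\<dots> = (\<integral>z. U z * (v (fst z) * E (Suc m + j) (snd z)) \<partial>lborel)"
        by (rule integral_iterated(1)[symmetric, OF integrable_prod[OF v(1) mE E_bd]])
      also have "\<dots> = 0" by (rule laplace) simp
      finally show ?thesis .
    qed
    show "\<exists>t. \<forall>y\<in>{0<..}. s < y \<longleftrightarrow> E 1 y < t" for s
      by (rule exI[of _ "exp (- s)"]) (simp add: E_def)
  qed
  then show ?thesis by eventually_elim (simp add: E_def)
qed

text \<open>Countably many m leave a common null set of \<open>y\<close>; off it, all root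
  coefficients of the slice vanish and completeness applies.\<close>

lemma vanishes: "AE z in lborel. U z = 0"
proof -
  have [measurable]: "U \<in> borel_measurable borel" using borel_measurable_integrable[OF integrable_U] by simp
  have sins: "AE y in lborel. (\<integral>x. U (x, y) * sin (real m * x) \<partial>lborel) = 0" for m :: nat
  proof (rule coefficient_vanishes[where r = "\<lambda>_. 0" and m = m and v' = "\<lambda>x. real m * cos (real m * x)"])
    show "sin (real m * (2 * pi)) = 0" "real m * cos (real m * 0) = real m * cos (real m * (2 * pi))"
      using sin_2npi[of m] cos_2npi[of m] by (simp_all add: mult.commute mult.left_commute)
  qed (auto intro!: smooth_sin smooth_const derivative_eq_intros simp: power2_eq_square)
  \<comment> \<open>The second link of the Jordan chain: its remainder \<open>r\<close> is 2 m sin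
    (m x), whose coefficient has just been shown to vanish.\<close>
  have coss: "AE y in lborel. (\<integral>x. U (x, y) * ((2 * pi - x) * cos (real m * x)) \<partial>lborel) = 0" for m :: nat
  proof (rule coefficient_vanishes[where r = "\<lambda>x. 2 * real m * sin (real m * x)" and m = m
        and v' = "\<lambda>x. - cos (real m * x) - real m * (2 * pi - x) * sin (real m * x)"])
    show "- cos (real m * 0) - real m * (2 * pi - 0) * sin (real m * 0) =
        - cos (real m * (2 * pi)) - real m * (2 * pi - 2 * pi) * sin (real m * (2 * pi))"
      using cos_2npi[of m] by (simp add: mult.commute mult.left_commute)
    show "AE y in lborel. (\<integral>x. U (x, y) * (2 * real m * sin (real m * x)) \<partial>lborel) = 0"
      using sins[of m] by eventually_elim (simp add: mult.left_commute mult.assoc)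
    show "((\<lambda>x. - cos (real m * x) - real m * (2 * pi - x) * sin (real m * x)) has_real_derivative
       2 * real m * sin (real m * x) - (real m)\<^sup>2 * ((2 * pi - x) * cos (real m * x))) (at x)" for x
      by (auto intro!: derivative_eq_intros simp: power2_eq_square algebra_simps)
    show "((\<lambda>x. (2 * pi - x) * cos (real m * x)) has_real_derivative - cos (real m * x) - real m * (2 * pi - x) * sin (real m * x)) (at x)" for x
      by (auto intro!: derivative_eq_intros simp: algebra_simps)
    show "smooth (\<lambda>x. (2 * pi - x) * cos (real m * x))" "smooth (\<lambda>x. 2 * real m * sin (real m * x))"
      by (intro smooth_mult smooth_diff smooth_const smooth_ident smooth_cos smooth_sin)+
  qed simp
  have "integrable (lborel \<Otimes>\<^sub>M lborel) (\<lambda>(x, y). U (x, y))"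
    using integrable_U by (simp add: lborel_prod)
  from lborel_pair.AE_integrable_snd[OF this]
  have slices: "AE y in lborel. integrable lborel (\<lambda>x. U (x, y))" .
  have "AE y in lborel. \<forall>m::nat. (\<integral>x. U (x, y) * sin (m * x) \<partial>lborel) = 0"
    "AE y in lborel. \<forall>m::nat. (\<integral>x. U (x, y) * ((2 * pi - x) * cos (m * x)) \<partial>lborel) = 0"
    using sins coss by (simp_all add: AE_all_countable)
  with slices have zero: "AE y in lborel. AE x in lborel. U (x, y) = 0"
  proof eventually_elim
    case (elim y)
    show ?case
      by (rule root_functions_complete) (use elim U_supp in \<open>auto simp: strip_def\<close>)
  qed
  have Um [measurable]: "U \<in> borel_measurable (lborel \<Otimes>\<^sub>M lborel)"
    by (simp add: lborel_prod)
  have meas: "{z \<in> space (lborel \<Otimes>\<^sub>M lborel). U (fst z, snd z) = 0} \<in> sets (lborel \<Otimes>\<^sub>M lborel)"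
    unfolding prod.collapse by measurable
  from zero lborel_pair.AE_commute[OF meas] have "AE x in lborel. AE y in lborel. U (x, y) = 0"
    by simp
  then have "AE z in lborel \<Otimes>\<^sub>M lborel. U z = 0"
    by (rule lborel_pair.AE_pair_measure[OF meas[unfolded prod.collapse]])
  then show ?thesis unfolding lborel_prod .
qed

end

text \<open>Both solutions satisfy Green's identity with the same right-hand side, which cancels on
  subtraction. The rest carries integrals over the completed measure on the strip to a Borel
  function on the plane.\<close>

lemma weak_solutions_difference:
  assumes p: "1 < p" and \<nu>: "\<nu> \<in> Muckenhoupt p"
    and f: "f \<in> borel_measurable (lebesgue_on {0<..<2 * pi})"
    and sol: "weak_solution p \<nu> f h u\<^sub>1" "weak_solution p \<nu> f h u\<^sub>2"
    and U: "U \<in> borel_measurable borel" "AE z in lborel. U z = indicator strip z * (u\<^sub>1 z - u\<^sub>2 z)"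
    and U_supp: "\<And>z. z \<notin> strip \<Longrightarrow> U z = 0"
  shows "homogeneous_solution U"
proof
  let ?S = "lebesgue_on strip"
  have int: "integrable ?S u\<^sub>1" "integrable ?S u\<^sub>2"
    using sol Lp_strip_integrable[OF p \<nu>] by (auto simp: weak_solution_def W1p_strip_def)
  have transfer: "(\<lambda>z. indicator strip z *\<^sub>R q z) \<in> borel_measurable lebesgue"
    if "q \<in> borel_measurable ?S" for q :: "real \<times> real \<Rightarrow> real"
    using that by (subst (asm) borel_measurable_restrict_space_iff) auto
  have Ul: "AE z in lebesgue. U z = indicator strip z * (u\<^sub>1 z - u\<^sub>2 z)"
    by (rule AE_completion[OF U(2)])
  have "integrable lebesgue (\<lambda>z. indicator strip z *\<^sub>R (u\<^sub>1 z - u\<^sub>2 z))"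
    using Bochner_Integration.integrable_diff[OF int] by (subst (asm) integrable_restrict_space) auto
  also have "?this \<longleftrightarrow> integrable lebesgue U"
  proof (rule integrable_cong_AE)
    show "(\<lambda>z. indicator strip z *\<^sub>R (u\<^sub>1 z - u\<^sub>2 z)) \<in> borel_measurable lebesgue"
      by (rule transfer) (use int in auto)
    show "U \<in> borel_measurable lebesgue" using U(1) by (intro measurable_completion) simp
    show "AE z in lebesgue. indicator strip z *\<^sub>R (u\<^sub>1 z - u\<^sub>2 z) = U z"
      using Ul by eventually_elim simp
  qed
  finally show "integrable lborel U" using U(1) by (simp add: integrable_completion)
  show "U z = 0" if "z \<notin> strip" for z by (rule U_supp[OF that])
  fix a a' a'' b b' b'' :: "real \<Rightarrow> real" and \<xi>
  assume ab: "smooth a" "\<And>x. (a has_real_derivative a' x) (at x)" "\<And>x. (a' has_real_derivative a'' x) (at x)"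
    "smooth b" "\<And>y. (b has_real_derivative b' y) (at y)" "\<And>y. (b' has_real_derivative b'' y) (at y)"
    "a (2 * pi) = 0" "a' 0 = a' (2 * pi)" "b 0 = 0" "0 < \<xi>"
    "\<And>y. \<xi> \<le> y \<Longrightarrow> b y = 0 \<and> b' y = 0 \<and> b'' y = 0"
  let ?W = "\<lambda>z. a'' (fst z) * b (snd z) + a (fst z) * b'' (snd z)"
  have sm: "smooth a''" "smooth b''" using smooth_DERIV_cong ab(1-6) by blast+
  have Wm: "?W \<in> borel_measurable borel"
    using ab(1,4) sm by (intro borel_measurable_add prod_borel_measurable smooth_measurable)
  \<comment> \<open>A bound on the infinite strip follows from one on a rectangle because the factor
    in y vanishes from \<xi> on.\<close>
  have prod_bd: "\<exists>C. \<forall>z\<in>strip. \<bar>c (fst z) * d (snd z)\<bar> \<le> C"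
    if cd: "smooth c" "smooth d" and d0: "\<And>y. \<xi> \<le> y \<Longrightarrow> d y = 0" for c d
  proof -
    obtain C where C: "0 \<le> C" "\<And>z. z \<in> rectangle \<xi> \<Longrightarrow> \<bar>c (fst z) * d (snd z)\<bar> \<le> C"
      using prod_bounded_rectangle[OF cd] by blast
    have "\<bar>c (fst z) * d (snd z)\<bar> \<le> C" if "z \<in> strip" for z
    proof (cases "snd z < \<xi>")
      case True then show ?thesis using that by (intro C) (auto simp: strip_def rectangle_def)
    next
      case False then show ?thesis using C(1) by (simp add: d0)
    qed
    then show ?thesis by blast
  qed
  obtain C\<^sub>1 where C1: "\<And>z. z \<in> strip \<Longrightarrow> \<bar>a'' (fst z) * b (snd z)\<bar> \<le> C\<^sub>1"
    using prod_bd[OF sm(1) ab(4)] ab(11) by blast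
  obtain C\<^sub>2 where C2: "\<And>z. z \<in> strip \<Longrightarrow> \<bar>a (fst z) * b'' (snd z)\<bar> \<le> C\<^sub>2"
    using prod_bd[OF ab(1) sm(2)] ab(11) by blast
  have W: "\<bar>?W z\<bar> \<le> C\<^sub>1 + C\<^sub>2" if "z \<in> strip" for z using C1[OF that] C2[OF that] by linarith
  have intW: "integrable ?S (\<lambda>z. u z * ?W z)" if "integrable ?S u" for u
    by (rule integrable_mult_bounded[OF that lebesgue_on_measurableI[OF Wm], of "C\<^sub>1 + C\<^sub>2"]) (use W in auto)
  have "(\<integral>z. U z * ?W z \<partial>lborel) = (\<integral>z. U z * ?W z \<partial>lebesgue)"
    using U(1) Wm by (intro integral_completion[symmetric]) simp
  also have "\<dots> = (\<integral>z. indicator strip z *\<^sub>R (u\<^sub>1 z * ?W z - u\<^sub>2 z * ?W z) \<partial>lebesgue)"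
  proof (rule integral_cong_AE)
    show "(\<lambda>z. U z * ?W z) \<in> borel_measurable lebesgue"
      using U(1) Wm by (intro measurable_completion) simp
    show "(\<lambda>z. indicator strip z *\<^sub>R (u\<^sub>1 z * ?W z - u\<^sub>2 z * ?W z)) \<in> borel_measurable lebesgue"
      by (rule transfer) (use intW[OF int(1)] intW[OF int(2)] in auto)
    show "AE z in lebesgue. U z * ?W z = indicator strip z *\<^sub>R (u\<^sub>1 z * ?W z - u\<^sub>2 z * ?W z)"
      using Ul by eventually_elim (simp add: left_diff_distrib)
  qed
  also have "\<dots> = (LINT z|?S. u\<^sub>1 z * ?W z - u\<^sub>2 z * ?W z)"
    by (subst integral_restrict_space) auto
  also have "\<dots> = (LINT z|?S. u\<^sub>1 z * ?W z) - (LINT z|?S. u\<^sub>2 z * ?W z)"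
    by (intro Bochner_Integration.integral_diff intW int)
  also have "\<dots> = 0"
    using weak_solution_identity[OF p \<nu> f sol(1) ab] weak_solution_identity[OF p \<nu> f sol(2) ab] by simp
  finally show "(\<integral>z. U z * ?W z \<partial>lborel) = 0" .
qed

theorem theorem3p2:
  fixes p :: real
    and \<nu> :: "real \<Rightarrow> ennreal"
    and f h :: "real \<Rightarrow> real"
    and u\<^sub>1 u\<^sub>2 :: "real \<times> real \<Rightarrow> real"
  assumes "1 < p"
    and "\<nu> \<in> Muckenhoupt p"
    and "AE x in lebesgue_on {0<..<2 * pi}. \<nu> x = \<nu> (2 * pi - x)"
    and "f \<in> W1p_interval p \<nu>"
    and "endpoint_values f 0 0"
    and "integrable (lebesgue_on {0<..}) h"
    and "weak_solution p \<nu> f h u\<^sub>1"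
    and "weak_solution p \<nu> f h u\<^sub>2"
  shows "AE z in lebesgue_on strip. u\<^sub>1 z = u\<^sub>2 z"
proof -
  have f: "f \<in> borel_measurable (lebesgue_on {0<..<2 * pi})"
    using assms(4) by (auto simp: W1p_interval_def Lp_interval_def)
  have "u\<^sub>1 \<in> borel_measurable (lebesgue_on strip)" "u\<^sub>2 \<in> borel_measurable (lebesgue_on strip)"
    using assms(7,8) by (auto simp: weak_solution_def W1p_strip_def Lp_strip_def)
  then have diff: "(\<lambda>z. u\<^sub>1 z - u\<^sub>2 z) \<in> borel_measurable (lebesgue_on strip)" by measurable
  obtain U' where U': "U' \<in> borel_measurable borel"
    "AE z in lborel. U' z = indicator strip z * (u\<^sub>1 z - u\<^sub>2 z)"
    by (rule borel_representative[OF strip_sets(1) diff])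
  \<comment> \<open>The Borel version is zero outside the strip only almost everywhere; the
    indicator makes it zero at every outside point, as arguments on single slices require.\<close>
  define U where "U z = indicator strip z * U' z" for z
  have U: "U \<in> borel_measurable borel"
    unfolding U_def[abs_def] using U'(1) by (intro borel_measurable_times borel_measurable_indicator) auto
  have ae: "AE z in lborel. U z = indicator strip z * (u\<^sub>1 z - u\<^sub>2 z)"
    using U'(2) by eventually_elim (simp add: U_def indicator_def)
  interpret homogeneous_solution U
    by (rule weak_solutions_difference[OF assms(1,2) f assms(7,8) U ae]) (simp add: U_def)
  from vanishes ae have "AE z in lborel. z \<in> strip \<longrightarrow> u\<^sub>1 z = u\<^sub>2 z"
    by eventually_elim (simp add: indicator_def)
  then show ?thesis
    by (subst AE_restrict_space_iff) (auto dest: AE_completion)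
qed

end
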